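(* Let $A$ be a bounded pseudo-BCK algebra. For any Bosbach state $s$ on $A$ there is a unique Borel probability measure $\mu$ on $\mathcal B(\mathcal{BS}(A))$ such that $$s(a)=\int_{\mathcal{SM}(A)}\tilde a(x)\,d\mu(x)\quad\text{for all } a\in A,$$ where $\tilde a:\mathcal{BS}(A)\to[0,1]$ is defined by $\tilde a(t)=t(a)$.
   Context: A pseudo-BCK algebra is a structure $(A,\le,\rightarrow,\rightsquigarrow,1)$ with $\le$ a binary relation, $\rightarrow,\rightsquigarrow$ binary operations and $1\in A$, such that for all $x,y,z\in A$: $x\rightarrow y\le (y\rightarrow z)\rightsquigarrow(x\rightarrow z)$ and $x\rightsquigarrow y\le (y\rightsquigarrow z)\rightarrow(x\rightsquigarrow z)$; $x\le (x\rightarrow y)\rightsquigarrow y$ and $x\le (x\rightsquigarrow y)\rightarrow y$; $x\le x$; $x\le 1$; antisymmetry of $\le$; $x\le y$ iff $x\rightarrow y=1$ iff $x\rightsquigarrow y=1$. It is bounded if it has a least element $0$. A Bosbach state is a map $s:A\to[0,1]$ with $s(x)+s(x\rightarrow y)=s(y)+s(y\rightarrow x)$, $s(x)+s(x\rightsquigarrow y)=s(y)+s(y\rightsquigarrow x)$, $s(0)=0$, $s(1)=1$; $\mathcal{BS}(A)$ is the set of Bosbach states with the weak topology (pointwise convergence on $A$), a compact Hausdorff space. $\mathcal{SM}(A)\subseteq\mathcal{BS}(A)$ is the (closed) set of state-morphisms, i.e. maps $m:A\to[0,1]$ with $m(0)=0$ and $m(x\rightarrow y)=m(x\rightsquigarrow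 y)=\min\{1-m(x)+m(y),1\}$. $\mathcal B(\cdot)$ denotes the Borel $\sigma$-algebra.
   Formalization: "Borel probability measure" is taken to be regular: a regular one exists and is unique among regular ones. Without regularity uniqueness fails, e.g. for the clopen algebra of ω₁+1, where the point mass at ω₁ and the Dieudonné measure represent the same Bosbach state. *)

theory Defs
  imports "HOL-Probability.Probability"
begin

text \<open>The carrier of the algebra is the whole type \<^typ>\<open>'a\<close>.\<close>

locale pseudo_bck =
  fixes le :: "'a \<Rightarrow> 'a \<Rightarrow> bool" (infix "\<sqsubseteq>" 50)
    and arr :: "'a \<Rightarrow> 'a \<Rightarrow> 'a" (infixr "\<rightarrow>" 60)
    and sqg :: "'a \<Rightarrow> 'a \<Rightarrow> 'a" (infixr "\<leadsto>" 60)
    and one :: 'a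
  assumes arr_trans: "x \<rightarrow> y \<sqsubseteq> (y \<rightarrow> z) \<leadsto> (x \<rightarrow> z)"
    and sqg_trans: "x \<leadsto> y \<sqsubseteq> (y \<leadsto> z) \<rightarrow> (x \<leadsto> z)"
    and arr_sqg: "x \<sqsubseteq> (x \<rightarrow> y) \<leadsto> y"
    and sqg_arr: "x \<sqsubseteq> (x \<leadsto> y) \<rightarrow> y"
    and le_refl: "x \<sqsubseteq> x"
    and le_one: "x \<sqsubseteq> one"
    and le_antisym: "x \<sqsubseteq> y \<Longrightarrow> y \<sqsubseteq> x \<Longrightarrow> x = y"
    and le_iff_arr: "x \<sqsubseteq> y \<longleftrightarrow> x \<rightarrow> y = one"
    and le_iff_sqg: "x \<sqsubseteq> y \<longleftrightarrow> x \<leadsto> y = one"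

locale bounded_pseudo_bck = pseudo_bck le arr sqg one
  for le :: "'a \<Rightarrow> 'a \<Rightarrow> bool" (infix "\<sqsubseteq>" 50)
    and arr :: "'a \<Rightarrow> 'a \<Rightarrow> 'a" (infixr "\<rightarrow>" 60)
    and sqg :: "'a \<Rightarrow> 'a \<Rightarrow> 'a" (infixr "\<leadsto>" 60)
    and one :: 'a +
  fixes zero :: 'a
  assumes zero_le: "zero \<sqsubseteq> x"

definition bosbach_states ::
  "('a \<Rightarrow> 'a \<Rightarrow> 'a) \<Rightarrow> ('a \<Rightarrow> 'a \<Rightarrow> 'a) \<Rightarrow> 'a \<Rightarrow> 'a \<Rightarrow> ('a \<Rightarrow> real) set"
  where "bosbach_states arr sqg one zero =
    {s. (\<forall>x. s x \<in> {0..1}) \<and>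
        (\<forall>x y. s x + s (arr x y) = s y + s (arr y x)) \<and>
        (\<forall>x y. s x + s (sqg x y) = s y + s (sqg y x)) \<and>
        s zero = 0 \<and> s one = 1}"

definition state_morphisms ::
  "('a \<Rightarrow> 'a \<Rightarrow> 'a) \<Rightarrow> ('a \<Rightarrow> 'a \<Rightarrow> 'a) \<Rightarrow> 'a \<Rightarrow> ('a \<Rightarrow> real) set"
  where "state_morphisms arr sqg zero =
    {m. (\<forall>x. m x \<in> {0..1}) \<and> m zero = 0 \<and>
        (\<forall>x y. m (arr x y) = min (1 - m x + m y) 1) \<and>
        (\<forall>x y. m (sqg x y) = min (1 - m x + m y) 1)}"

text \<open>A Borel probability measure on the compact Hausdorff subspace \<open>X\<close> is taken to be regular.
  Without regularity a Borel measure on a non-metrizable compact Hausdorff space is not determined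
  by the integrals of continuous functions: on the ordinal space \<open>[0, \<omega>\<^sub>1]\<close>
  the Dieudonne measure and the point mass at \<open>\<omega>\<^sub>1\<close> agree on all continuous functions.

  For \<open>X\<close> a set of functions \<^typ>\<open>'a \<Rightarrow> real\<close>, the ambient topology is the library's
  product topology on the function type, so \<open>X\<close> carries the topology of pointwise
  convergence; \<^term>\<open>restrict_space borel X\<close> is then the Borel \<open>\<sigma>\<close>-algebra
  of the subspace \<open>X\<close>.\<close>

definition regular_borel_prob_on :: "'b::topological_space set \<Rightarrow> 'b measure \<Rightarrow> bool"
  where "regular_borel_prob_on X \<mu> \<longleftrightarrow>
    sets \<mu> = sets (restrict_space borel X) \<and>
    prob_space \<mu> \<and>
    (\<forall>B\<in>sets \<mu>.
      emeasure \<mu> B = (SUP K\<in>{K. compact K \<and> K \<subseteq> B}. emeasure \<mu> K) \<and>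
      emeasure \<mu> B = (INF U\<in>{U. openin (top_of_set X) U \<and> B \<subseteq> U}. emeasure \<mu> U))"

end

theory Submission
  imports Defs
begin

text \<open>
  Modulo the kernel of a Bosbach state \<open>t\<close>, joins are symmetric, and
  \<open>x \<rightarrow> y\<close> and \<open>x \<leadsto> y\<close> have the same \<open>t\<close>-value; this suffices to split \<open>t\<close>,
  for given \<open>a\<close> and \<open>b\<close>, into a state that is \<open>1\<close> at \<open>a \<rightarrow> b\<close> and one that is \<open>1\<close>
  at \<open>b \<rightarrow> a\<close>.  A Bosbach state that is \<open>1\<close> at one element of each such pair is a
  state-morphism, so by compactness of the space of Bosbach states some state-morphism lies below
  \<open>t\<close> at any prescribed element.  Hence \<open>t\<close> depends only on the functions induced on the
  compact space of state-morphisms, is monotone and additive on them, and these functions form a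
  separating MV-algebra of \<open>[0, 1]\<close>-valued functions.

  Such an algebra contains Urysohn functions for disjoint compact sets, so the construction of the
  Riesz measure works with its elements in place of all continuous functions.  Urysohn functions also
  show that any two representing measures agree on compact sets.
\<close>

subsection \<open>Bosbach states modulo their kernel\<close>

text \<open>The axioms are symmetric in the two implications; through \<open>dual\<close>, facts
  proved for one implication are also available with the two exchanged.\<close>

lemma (in bounded_pseudo_bck) dual_bck: "bounded_pseudo_bck le sqg arr one zero"
  using bounded_pseudo_bck_axioms
  unfolding bounded_pseudo_bck_def pseudo_bck_def bounded_pseudo_bck_axioms_def by blast

locale bosbach_state = bounded_pseudo_bck le arr sqg one zero
  for le :: "'a \<Rightarrow> 'a \<Rightarrow> bool" (infix "\<sqsubseteq>" 50)
    and arr :: "'a \<Rightarrow> 'a \<Rightarrow> 'a" (infixr "\<rhd>" 60)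
    and sqg :: "'a \<Rightarrow> 'a \<Rightarrow> 'a" (infixr "\<leadsto>" 60)
    and one zero :: 'a +
  fixes t :: "'a \<Rightarrow> real"
  assumes state: "t \<in> bosbach_states arr sqg one zero"
begin

lemma dual: "bosbach_state le sqg arr one zero t"
  using state dual_bck unfolding bosbach_state_def bosbach_state_axioms_def bosbach_states_def
  by auto

section \<open>Order and residuation in pseudo-BCK algebras\<close>

lemma one_le_iff: "one \<sqsubseteq> x \<longleftrightarrow> x = one"
  using le_antisym le_one le_refl by blast

lemma one_arr: "one \<rhd> x = x"
proof (rule le_antisym)
  show "one \<rhd> x \<sqsubseteq> x"
    by (metis arr_sqg one_le_iff le_iff_sqg)
  show "x \<sqsubseteq> one \<rhd> x"
    by (metis sqg_arr le_refl le_iff_sqg)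
qed

lemma antitone: "x \<sqsubseteq> y \<Longrightarrow> y \<rhd> z \<sqsubseteq> x \<rhd> z"
  using arr_trans[of x y z] by (metis le_iff_arr le_iff_sqg one_le_iff)

lemma le_trans: "x \<sqsubseteq> y \<Longrightarrow> y \<sqsubseteq> z \<Longrightarrow> x \<sqsubseteq> z"
  using antitone[of x y z] by (metis le_iff_arr one_le_iff)

lemma le_arr_self: "y \<sqsubseteq> x \<rhd> y"
  using antitone[OF le_one[of x], of y] by (simp add: one_arr)

text \<open>From \<open>x \<sqsubseteq> y \<rhd> z\<close>, antitonicity gives
  \<open>(y \<rhd> z) \<leadsto> z \<sqsubseteq> x \<leadsto> z\<close>, whose left side lies above
  \<open>y\<close>; the converse is dual. With no product in the signature, this takes the place of
  residuation.\<close>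

lemma le_arr_iff: "x \<sqsubseteq> y \<rhd> z \<longleftrightarrow> y \<sqsubseteq> x \<leadsto> z"
  by (meson antitone arr_sqg bosbach_state.antitone dual le_trans sqg_arr)

text \<open>Each inequality is transitivity of implication followed by antitonicity at
  \<open>y \<sqsubseteq> (y \<leadsto> z) \<rhd> z\<close>.\<close>

lemma exchange: "x \<rhd> (y \<leadsto> z) = y \<leadsto> (x \<rhd> z)"
proof -
  have *: "f x (g y z) \<sqsubseteq> g y (f x z)" if "bosbach_state le f g one zero t"
    for f g :: "'a \<Rightarrow> 'a \<Rightarrow> 'a" and x y z
  proof -
    interpret B: bosbach_state le f g one zero t by fact
    interpret D: bosbach_state le g f one zero t by (rule B.dual)
    show ?thesis
      by (rule B.le_trans[OF B.arr_trans D.antitone[OF B.sqg_arr]])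
  qed
  show ?thesis
    by (rule le_antisym[OF *[OF bosbach_state_axioms] *[OF dual]])
qed

lemma arr_lift: "x \<rhd> y \<sqsubseteq> (z \<rhd> x) \<rhd> (z \<rhd> y)"
  by (rule iffD2[OF le_arr_iff arr_trans])

lemma arr_mono: "x \<sqsubseteq> y \<Longrightarrow> z \<rhd> x \<sqsubseteq> z \<rhd> y"
  using arr_lift[of x y z] by (metis le_iff_arr one_le_iff)

text \<open>The term \<open>(x \<rhd> y) \<leadsto> y\<close> serves as a join. In general it is
  only an upper bound; symmetry and leastness are recovered modulo the kernel of
  \<open>t\<close>.\<close>

lemma le_join: "x \<sqsubseteq> (x \<rhd> y) \<leadsto> y" "y \<sqsubseteq> (x \<rhd> y) \<leadsto> y"
  using arr_sqg bosbach_state.le_arr_self[OF dual] by auto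

lemma join_arr: "((x \<rhd> y) \<leadsto> y) \<rhd> y = x \<rhd> y"
  by (meson antitone arr_sqg le_antisym sqg_arr)

section \<open>Values of a Bosbach state on implications and joins\<close>

lemma t_one: "t one = 1" and t_zero: "t zero = 0" and t_ge: "0 \<le> t x" and t_le: "t x \<le> 1"
  and t_arr: "t x + t (x \<rhd> y) = t y + t (y \<rhd> x)"
  using state by (auto simp: bosbach_states_def)

lemma t_arr_below: "x \<sqsubseteq> y \<Longrightarrow> t (y \<rhd> x) = 1 - t y + t x"
  using t_arr[of x y] by (simp add: le_iff_arr t_one)

lemma t_mono: "x \<sqsubseteq> y \<Longrightarrow> t x \<le> t y"
  using t_arr_below[of x y] t_le[of "y \<rhd> x"] by simp

lemma t_join: "t ((x \<rhd> y) \<leadsto> y) = 1 + t y - t (x \<rhd> y)"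
  using t_arr_below[OF le_join(2), of x y] by (simp add: join_arr)

lemma t_join_commute: "t ((x \<rhd> y) \<leadsto> y) = t ((y \<rhd> x) \<leadsto> x)"
  using t_arr[of x y] by (simp add: t_join)

lemma t_arr_same: "x \<sqsubseteq> y \<Longrightarrow> t x = t y \<Longrightarrow> t (y \<rhd> x) = 1"
  using t_arr_below[of x y] by simp

text \<open>Both joins lie below an element \<open>j\<close> of the same value, so
  \<open>j \<rhd> w'\<close> has value 1, and antitonicity carries this to
  \<open>w \<rhd> w'\<close>.\<close>

lemma join_commute: "t (((x \<rhd> y) \<leadsto> y) \<rhd> ((y \<rhd> x) \<leadsto> x)) = 1"
proof -
  define w where "w = (x \<rhd> y) \<leadsto> y"
  define w' where "w' = (y \<rhd> x) \<leadsto> x"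
  \<comment> \<open>Replacing \<open>y\<close> by the larger \<open>w\<close> in \<open>w'\<close>
    gives an element above \<open>w'\<close>; as \<open>x\<close> lies below \<open>w\<close>, its
    value is still \<open>t w\<close>.\<close>
  define j where "j = (w \<rhd> x) \<leadsto> x"
  have "x \<sqsubseteq> w" "y \<sqsubseteq> w" unfolding w_def by (rule le_join)+
  have "w \<sqsubseteq> j" unfolding j_def by (rule le_join)
  have "w' \<sqsubseteq> j" unfolding w'_def j_def
    by (intro bosbach_state.antitone[OF dual] antitone \<open>y \<sqsubseteq> w\<close>)
  have "t j = t w"
    unfolding j_def using \<open>x \<sqsubseteq> w\<close> t_join[of w x] t_arr_below[of x w] by simp
  moreover have "t w = t w'" unfolding w_def w'_def by (rule t_join_commute)
  ultimately have "t (j \<rhd> w') = 1"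
    using \<open>w' \<sqsubseteq> j\<close> by (simp add: t_arr_same)
  then show ?thesis
    using t_mono[OF antitone[OF \<open>w \<sqsubseteq> j\<close>, of w']] t_le[of "w \<rhd> w'"] by (simp add: w_def w'_def)
qed

lemma t_join_least:
  assumes "x \<sqsubseteq> z" "y \<sqsubseteq> z"
  shows "t ((x \<rhd> y) \<leadsto> y) \<le> t z"
proof -
  have "t ((x \<rhd> y) \<leadsto> y) \<le> t ((z \<rhd> y) \<leadsto> y)"
    by (intro t_mono bosbach_state.antitone[OF dual] antitone assms)
  also have "\<dots> = t z" using t_join[of z y] t_arr_below[OF assms(2)] by simp
  finally show ?thesis .
qed

text \<open>The joins formed with \<open>\<rhd>\<close> first and with \<open>\<leadsto>\<close>
  first are both upper bounds of least value. So their values agree, and \<open>t_join\<close>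
  recovers the values of the implications.\<close>

lemma t_arr_eq_sqg: "t (x \<rhd> y) = t (x \<leadsto> y)"
proof -
  have "t ((x \<rhd> y) \<leadsto> y) = t ((x \<leadsto> y) \<rhd> y)"
    by (intro antisym t_join_least bosbach_state.t_join_least[OF dual] le_join
        bosbach_state.le_join[OF dual])
  then show ?thesis by (simp add: t_join bosbach_state.t_join[OF dual])
qed

section \<open>The order modulo the kernel and prelinearity\<close>

lemma t_mp: "t (x \<rhd> y) = 1 \<Longrightarrow> t x \<le> t y"
  using t_arr[of x y] t_le[of "y \<rhd> x"] by simp

lemma t_eq_one_mono: "x \<sqsubseteq> y \<Longrightarrow> t x = 1 \<Longrightarrow> t y = 1"
  using t_mono[of x y] t_le[of y] by simp

text \<open>The relation \<open>t (x \<rhd> y) = 1\<close> is the order of the quotient of the algebra by the kernel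
  of \<open>t\<close>.\<close>

definition mod_le :: "'a \<Rightarrow> 'a \<Rightarrow> bool" (infix "\<preceq>" 50) where "x \<preceq> y \<longleftrightarrow> t (x \<rhd> y) = 1"

lemma dual_mod_le: "bosbach_state.mod_le sqg t x y \<longleftrightarrow> x \<preceq> y"
  by (simp add: bosbach_state.mod_le_def[OF dual] mod_le_def t_arr_eq_sqg)

lemma mod_le_sqg: "x \<preceq> y \<longleftrightarrow> t (x \<leadsto> y) = 1"
  by (simp add: mod_le_def t_arr_eq_sqg)

lemma le_imp_mod_le: "x \<sqsubseteq> y \<Longrightarrow> x \<preceq> y"
  by (simp add: mod_le_def le_iff_arr t_one)

lemma mod_le_antitone: "x \<preceq> y \<Longrightarrow> y \<rhd> z \<preceq> x \<rhd> z"
  unfolding mod_le_sqg[of "y \<rhd> z"] unfolding mod_le_def using arr_trans t_eq_one_mono by blast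

lemma mod_le_trans [trans]: "x \<preceq> y \<Longrightarrow> y \<preceq> z \<Longrightarrow> x \<preceq> z"
  using mod_le_antitone[of x y z] t_mp[of "y \<rhd> z" "x \<rhd> z"] t_le[of "x \<rhd> z"]
  by (simp add: mod_le_def)

lemma mod_le_t_mono: "x \<preceq> y \<Longrightarrow> t x \<le> t y"
  unfolding mod_le_def by (rule t_mp)

lemma le_same_mod_le: "x \<sqsubseteq> y \<Longrightarrow> t x = t y \<Longrightarrow> y \<preceq> x"
  unfolding mod_le_def by (rule t_arr_same)

lemma mod_le_join_absorb: "x \<preceq> y \<Longrightarrow> (x \<rhd> y) \<leadsto> y \<preceq> y"
  by (rule le_same_mod_le[OF le_join(2)]) (simp add: t_join mod_le_def)

text \<open>Enlarging \<open>a\<close> to \<open>g\<close> leads to the join of \<open>g\<close> and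
  \<open>b\<close>; by symmetry modulo the kernel this is the join of \<open>b\<close> and
  \<open>g\<close>, which \<open>g\<close> absorbs.\<close>

lemma mod_le_join_least:
  assumes "a \<preceq> g" "b \<preceq> g"
  shows "(a \<rhd> b) \<leadsto> b \<preceq> g"
proof -
  have "(a \<rhd> b) \<leadsto> b \<preceq> (g \<rhd> b) \<leadsto> b"
    using bosbach_state.mod_le_antitone[OF dual, unfolded dual_mod_le] mod_le_antitone assms(1) by blast
  also have "(g \<rhd> b) \<leadsto> b \<preceq> (b \<rhd> g) \<leadsto> g"
    using join_commute by (simp add: mod_le_def)
  also have "(b \<rhd> g) \<leadsto> g \<preceq> g" using assms(2) by (rule mod_le_join_absorb)
  finally show ?thesis .
qed

text \<open>Modulo the kernel, \<open>j \<rhd> b\<close> may be replaced by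
  \<open>(b \<rhd> zero) \<leadsto> (j \<rhd> zero)\<close>, which has the same value. This turns
  the left side into the join of \<open>b \<rhd> zero\<close> with the smaller
  \<open>j \<rhd> zero\<close>.\<close>

lemma contraposition:
  assumes "b \<sqsubseteq> j"
  shows "(j \<rhd> b) \<rhd> (j \<rhd> zero) \<preceq> b \<rhd> zero"
proof -
  interpret D: bosbach_state le sqg arr one zero t by (rule dual)
  have neg: "j \<rhd> zero \<sqsubseteq> b \<rhd> zero" by (rule antitone[OF assms])
  have "(b \<rhd> zero) \<leadsto> (j \<rhd> zero) \<preceq> j \<rhd> b"
    by (rule le_same_mod_le[OF arr_trans])
      (simp add: t_arr_below[OF assms] D.t_arr_below[OF neg] t_arr_below zero_le t_zero)
  then have "(j \<rhd> b) \<rhd> (j \<rhd> zero) \<preceq> ((b \<rhd> zero) \<leadsto> (j \<rhd> zero)) \<rhd> (j \<rhd> zero)"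
    by (rule mod_le_antitone)
  also have "\<dots> \<preceq> b \<rhd> zero"
    by (rule le_same_mod_le[OF sqg_arr]) (simp add: D.t_join D.t_arr_below[OF neg])
  finally show ?thesis .
qed

text \<open>Contraposition bounds \<open>W\<close> by the negations of \<open>a\<close> and
  \<open>b\<close>, hence by that of their join \<open>j\<close>. So the join of \<open>w\<close>
  with \<open>j \<rhd> zero\<close> has value 1, and \<open>j \<rhd> zero\<close> already lies below
  \<open>w\<close>.\<close>

lemma prelinear: "t (((a \<rhd> b) \<rhd> (b \<rhd> a)) \<leadsto> (b \<rhd> a)) = 1"
proof -
  define w where "w = ((a \<rhd> b) \<rhd> (b \<rhd> a)) \<leadsto> (b \<rhd> a)"
  define j where "j = (a \<rhd> b) \<leadsto> b"
  define j' where "j' = (b \<rhd> a) \<leadsto> a"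
  define W where "W = w \<rhd> (j \<rhd> zero)"
  have w: "a \<rhd> b \<sqsubseteq> w" "b \<rhd> a \<sqsubseteq> w" unfolding w_def by (rule le_join)+
  have u: "a \<rhd> b = j \<rhd> b" and v: "b \<rhd> a = j' \<rhd> a"
    by (simp_all add: j_def j'_def join_arr)
  have "W \<preceq> (j \<rhd> b) \<rhd> (j \<rhd> zero)"
    unfolding W_def using antitone w(1) u le_imp_mod_le by simp
  also have "\<dots> \<preceq> b \<rhd> zero"
    by (rule contraposition) (simp add: j_def le_join)
  finally have Wb: "W \<preceq> b \<rhd> zero" .
  have "j' \<preceq> j" unfolding j_def j'_def mod_le_def by (rule join_commute)
  then have "j \<rhd> zero \<preceq> j' \<rhd> zero" by (rule mod_le_antitone)
  then have "W \<preceq> w \<rhd> (j' \<rhd> zero)"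
    unfolding W_def mod_le_def using arr_lift t_eq_one_mono by blast
  also have "\<dots> \<preceq> (j' \<rhd> a) \<rhd> (j' \<rhd> zero)"
    using antitone w(2) v le_imp_mod_le by simp
  also have "\<dots> \<preceq> a \<rhd> zero"
    by (rule contraposition) (simp add: j'_def le_join)
  finally have Wa: "W \<preceq> a \<rhd> zero" .
  have flip: "x \<preceq> W \<leadsto> zero \<longleftrightarrow> W \<preceq> x \<rhd> zero" for x
    unfolding mod_le_sqg[of W] by (simp add: mod_le_def exchange)
  have "j \<preceq> W \<leadsto> zero"
    unfolding j_def using Wa Wb flip by (intro mod_le_join_least) auto
  then have "t W \<le> t (j \<rhd> zero)" by (simp add: flip mod_le_t_mono)
  then have "1 \<le> t ((w \<rhd> (j \<rhd> zero)) \<leadsto> (j \<rhd> zero))"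
    by (simp add: t_join W_def)
  also have "\<dots> \<le> t w"
  proof (rule t_join_least[OF le_refl])
    show "j \<rhd> zero \<sqsubseteq> w" using arr_mono[OF zero_le, of j b] w(1) u le_trans by simp
  qed
  finally show ?thesis using t_le[of w] by (simp add: w_def)
qed

end

section \<open>Iterated implications and the splitting of a state\<close>

lemma normalized_state:
  fixes f :: "'a \<Rightarrow> real"
  assumes "0 < k" "\<And>x. 0 \<le> f x" "\<And>x. f x \<le> k" "f zero = 0" "f one = k"
    and "\<And>x y. f x + f (arr x y) = f y + f (arr y x)"
    and "\<And>x y. f x + f (sqg x y) = f y + f (sqg y x)"
  shows "(\<lambda>x. f x / k) \<in> bosbach_states arr sqg one zero"
  using assms by (simp add: bosbach_states_def flip: add_divide_distrib)

context bosbach_state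
begin

lemma le_iter: "w \<sqsubseteq> (arr u ^^ n) w"
proof (induction n)
  case (Suc n)
  show ?case using le_trans[OF Suc le_arr_self] by simp
qed (simp add: le_refl)

lemma iter_mono: "x \<sqsubseteq> y \<Longrightarrow> (arr u ^^ n) x \<sqsubseteq> (arr u ^^ n) y"
  by (induction n) (auto intro: arr_mono)

lemma iter_lift: "x \<rhd> y \<sqsubseteq> (arr u ^^ n) x \<rhd> (arr u ^^ n) y"
proof (induction n)
  case (Suc n)
  show ?case using le_trans[OF Suc arr_lift] by simp
qed (simp add: le_refl)

lemma iter_exchange: "(sqg u ^^ n) (x \<rhd> y) = x \<rhd> (sqg u ^^ n) y"
  by (induction n) (auto simp: exchange)

text \<open>Exchange moves a \<open>\<leadsto>\<close> step outermost, where it can become a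
  \<open>\<rhd>\<close> step without changing the value.\<close>

lemma t_iter_mixed: "t ((arr u ^^ n) ((sqg u ^^ k) w)) = t ((arr u ^^ (n + k)) w)"
proof (induction k arbitrary: n)
  case (Suc k)
  have "(arr u ^^ n) (u \<leadsto> x) = u \<leadsto> (arr u ^^ n) x" for x
    by (rule bosbach_state.iter_exchange[OF dual])
  then show ?case
    using Suc[of "Suc n"] by (simp flip: t_arr_eq_sqg)
qed simp

lemma t_iter_sqg: "t ((sqg u ^^ n) w) = t ((arr u ^^ n) w)"
  using t_iter_mixed[of 0] by simp

text \<open>Iterated modus ponens: each of the two terms on the left uses \<open>n\<close> copies of
  \<open>u\<close>, hence \<open>n + n\<close> on the right. The doubling disappears in the limit
  \<open>r\<close>.\<close>

lemma iter_upper: "t ((arr u ^^ n) x) + t ((arr u ^^ n) (x \<rhd> y)) \<le> 1 + t ((arr u ^^ (n + n)) y)"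
proof -
  let ?p = "(arr u ^^ n) x" and ?q = "(arr u ^^ n) ((sqg u ^^ n) y)"
  have "t ((arr u ^^ n) (x \<rhd> y)) = t (x \<rhd> (sqg u ^^ n) y)"
    by (simp add: iter_exchange flip: t_iter_sqg)
  also have "\<dots> \<le> t (?p \<rhd> ?q)" by (intro t_mono iter_lift)
  finally have "t ?p + t ((arr u ^^ n) (x \<rhd> y)) \<le> 1 + t ?q"
    using t_arr[of ?p ?q] t_le[of "?q \<rhd> ?p"] by simp
  then show ?thesis by (simp only: t_iter_mixed)
qed

text \<open>Iterating \<open>\<leadsto>\<close> instead of \<open>\<rhd>\<close> leaves the values
  unchanged and lets the iteration pass through \<open>x \<rhd> y\<close> by exchange.\<close>

lemma iter_lower:
  assumes "y \<sqsubseteq> x"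
  shows "1 + t ((arr u ^^ n) y) \<le> t ((arr u ^^ n) x) + t ((arr u ^^ n) (x \<rhd> y))"
proof -
  interpret D: bosbach_state le sqg arr one zero t by (rule dual)
  let ?p = "(sqg u ^^ n) x" and ?q = "(sqg u ^^ n) y"
  have "1 + t ?q = t ?p + t (?p \<rhd> ?q)"
    using t_arr_below[OF D.iter_mono[OF assms]] by simp
  also have "t (?p \<rhd> ?q) \<le> t (x \<rhd> ?q)" by (intro t_mono antitone D.le_iter)
  also have "\<dots> = t ((sqg u ^^ n) (x \<rhd> y))" by (simp add: iter_exchange)
  finally show ?thesis by (simp add: t_iter_sqg)
qed

text \<open>In the quotient, \<open>(arr u ^^ n) w\<close> is \<open>u^n \<rhd> w\<close>, so \<open>r u w - t w\<close> is the part of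
  \<open>1 - w\<close> that \<open>t\<close> sees within the ideal generated by \<open>1 - u\<close>.\<close>

definition r :: "'a \<Rightarrow> 'a \<Rightarrow> real" where "r u w = (SUP n. t ((arr u ^^ n) w))"

lemma dual_r: "bosbach_state.r sqg t u w = r u w"
  by (simp add: bosbach_state.r_def[OF dual] r_def t_iter_sqg)

lemma iter_le_r: "t ((arr u ^^ n) w) \<le> r u w"
  unfolding r_def by (intro cSUP_upper bdd_aboveI2[of _ _ 1]) (auto simp: t_le)

lemma r_LIMSEQ: "(\<lambda>n. t ((arr u ^^ n) w)) \<longlonglongrightarrow> r u w"
  unfolding r_def
  by (intro LIMSEQ_incseq_SUP bdd_aboveI2[of _ _ 1] incseq_SucI)
    (auto simp: t_le intro: t_mono le_arr_self)

lemma r_ge: "t w \<le> r u w"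
  using iter_le_r[where n = 0] by simp

lemma r_le: "r u w \<le> 1"
  by (rule LIMSEQ_le_const2[OF r_LIMSEQ]) (auto simp: t_le)

lemma r_one: "t w = 1 \<Longrightarrow> r u w = 1"
  using r_ge[of w u] r_le[of u w] by simp

lemma r_self: "r u u = 1"
  using iter_le_r[where n = 1 and u = u and w = u] r_le[of u u] le_refl[of u]
  by (simp add: le_iff_arr t_one)

lemma r_upper: "r u x + r u (x \<rhd> y) \<le> 1 + r u y"
proof (rule LIMSEQ_le_const2[OF tendsto_add[OF r_LIMSEQ r_LIMSEQ]], intro exI allI impI)
  fix n
  show "t ((arr u ^^ n) x) + t ((arr u ^^ n) (x \<rhd> y)) \<le> 1 + r u y"
    using iter_upper[of n u x y] iter_le_r[of "n + n" u y] by linarith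
qed

lemma r_below: "y \<sqsubseteq> x \<Longrightarrow> r u x + r u (x \<rhd> y) = 1 + r u y"
  by (intro antisym r_upper
      LIMSEQ_le[OF tendsto_add[OF tendsto_const r_LIMSEQ] tendsto_add[OF r_LIMSEQ r_LIMSEQ]])
    (auto intro: iter_lower)

text \<open>\<open>r_below\<close> expresses the values of joins under \<open>r u\<close>. By
  \<open>r_upper\<close>, \<open>r u\<close> is monotone modulo the kernel of \<open>t\<close>, so
  the symmetry of joins carries over.\<close>

lemma r_bosbach: "r u x + r u (x \<rhd> y) = r u y + r u (y \<rhd> x)"
proof -
  have join: "r u ((x \<rhd> y) \<leadsto> y) + r u (x \<rhd> y) = 1 + r u y" for x y
    using r_below[OF le_join(2), of u x y] by (simp add: join_arr)
  have "r u ((x \<rhd> y) \<leadsto> y) \<le> r u ((y \<rhd> x) \<leadsto> x)" for x y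
    using r_upper[of u "(x \<rhd> y) \<leadsto> y" "(y \<rhd> x) \<leadsto> x"] r_one[OF join_commute[of x y], of u]
    by simp
  from this[of x y] this[of y x] join[of x y] join[of y x] show ?thesis by simp
qed

lemma r_bosbach_sqg: "r u x + r u (x \<leadsto> y) = r u y + r u (y \<leadsto> x)"
  using bosbach_state.r_bosbach[OF dual] by (simp add: dual_r)

text \<open>By prelinearity \<open>?u \<rhd> ?v\<close> and \<open>?v\<close> agree modulo the
  kernel, so further iteration of \<open>?u\<close> does not raise the value of
  \<open>?v\<close>.\<close>

lemma r_orthogonal: "r (a \<rhd> b) (b \<rhd> a) = t (b \<rhd> a)"
proof -
  let ?u = "a \<rhd> b" and ?v = "b \<rhd> a"
  have "t (?u \<rhd> ?v) = t ?v"
    using t_join[of ?u ?v] prelinear[of a b] by simp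
  then have "t ((?u \<rhd> ?v) \<rhd> ?v) = 1" by (intro t_arr_same le_arr_self) simp
  then have "t ((arr ?u ^^ n) (?u \<rhd> ?v)) \<le> t ((arr ?u ^^ n) ?v)" for n
    using iter_lift t_eq_one_mono t_mp by blast
  then have "t ((arr ?u ^^ n) ?v) \<le> t ?v" for n
    by (induction n) (auto simp: funpow_swap1 intro: order_trans)
  then have "r ?u ?v \<le> t ?v" by (intro LIMSEQ_le_const2[OF r_LIMSEQ]) auto
  then show ?thesis using r_ge[of ?v ?u] by simp
qed

lemma zero_arr: "zero \<rhd> x = one" "zero \<leadsto> x = one"
  using zero_le le_iff_arr le_iff_sqg by auto

text \<open>With \<open>u = a \<rhd> b\<close> and \<open>c0 = r u zero\<close>, the state \<open>t\<close> is the convex combination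
  of \<open>(r u - c0) / (1 - c0)\<close> and \<open>(t - r u + c0) / c0\<close>; the first is \<open>1\<close> at \<open>a \<rhd> b\<close>,
  the second at \<open>b \<rhd> a\<close>, and one of them is at most \<open>t c\<close> at \<open>c\<close>.\<close>

lemma split:
  "\<exists>t'\<in>bosbach_states arr sqg one zero.
     t' c \<le> t c \<and> (\<forall>x. t x = 1 \<longrightarrow> t' x = 1) \<and> (t' (a \<rhd> b) = 1 \<or> t' (b \<rhd> a) = 1)"
proof -
  define R where "R = r (a \<rhd> b)"
  define c0 where "c0 = R zero"
  have R1: "R w = 1" if "t w = 1" for w using that by (simp add: R_def r_one)
  have Rle: "R w \<le> 1" and Rt: "t w \<le> R w" for w by (simp_all add: R_def r_le r_ge)
  have Rarr: "R x + R (x \<rhd> y) = R y + R (y \<rhd> x)" and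
    Rsqg: "R x + R (x \<leadsto> y) = R y + R (y \<leadsto> x)" for x y
    by (simp_all add: R_def r_bosbach r_bosbach_sqg)
  have Ru: "R (a \<rhd> b) = 1" and Rv: "R (b \<rhd> a) = t (b \<rhd> a)"
    by (simp_all add: R_def r_self r_orthogonal)
  have tsqg: "t x + t (x \<leadsto> y) = t y + t (y \<leadsto> x)" for x y
    by (rule bosbach_state.t_arr[OF dual])
  have Rge: "c0 \<le> R w" for w
    using Rarr[of zero w] Rle[of "w \<rhd> zero"] R1[OF t_one] by (simp add: c0_def zero_arr)
  have RtD: "R w - t w \<le> c0" for w
    using Rarr[of zero w] t_arr[of zero w] Rt[of "w \<rhd> zero"] R1[OF t_one] t_zero t_one
    by (simp add: c0_def zero_arr)
  have c0: "0 \<le> c0" "c0 \<le> 1" using Rt[of zero] t_zero Rle by (auto simp: c0_def)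
  consider "c0 = 0" | "c0 = 1" | "0 < c0" "c0 < 1" using c0 by linarith
  then show ?thesis
  proof cases
    \<comment> \<open>At the two endpoints one weight vanishes, and \<open>t\<close> itself already
      has value 1 at one of the two implications.\<close>
    case 1
    then have "t (a \<rhd> b) = 1" using RtD[of "a \<rhd> b"] Ru t_le[of "a \<rhd> b"] by simp
    then show ?thesis using state by blast
  next
    case 2
    then have "t (b \<rhd> a) = 1" using Rge[of "b \<rhd> a"] Rv t_le[of "b \<rhd> a"] by simp
    then show ?thesis using state by blast
  next
    case 3
    define t1 where "t1 = (\<lambda>w. (R w - c0) / (1 - c0))"
    define t2 where "t2 = (\<lambda>w. (t w - R w + c0) / c0)"
    have ends: "R zero = c0" "R one = 1" using R1[OF t_one] by (auto simp: c0_def)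
    have t1: "t1 \<in> bosbach_states arr sqg one zero"
      unfolding t1_def
    proof (rule normalized_state)
      show "R x - c0 + (R (x \<rhd> y) - c0) = R y - c0 + (R (y \<rhd> x) - c0)" for x y
        using Rarr[of x y] by simp
      show "R x - c0 + (R (x \<leadsto> y) - c0) = R y - c0 + (R (y \<leadsto> x) - c0)" for x y
        using Rsqg[of x y] by simp
    qed (use 3 Rge Rle ends in auto)
    have t2: "t2 \<in> bosbach_states arr sqg one zero"
      unfolding t2_def
    proof (rule normalized_state)
      show "t x - R x + c0 + (t (x \<rhd> y) - R (x \<rhd> y) + c0) =
          t y - R y + c0 + (t (y \<rhd> x) - R (y \<rhd> x) + c0)" for x y
        using Rarr[of x y] t_arr[of x y] by simp
      show "t x - R x + c0 + (t (x \<leadsto> y) - R (x \<leadsto> y) + c0) =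
          t y - R y + c0 + (t (y \<leadsto> x) - R (y \<leadsto> x) + c0)" for x y
        using Rsqg[of x y] tsqg[of x y] by simp
      show "0 \<le> t x - R x + c0" for x using RtD[of x] by simp
    qed (use 3 Rt ends t_one t_zero in auto)
    have "t1 (a \<rhd> b) = 1" "t2 (b \<rhd> a) = 1" using 3 by (simp_all add: t1_def t2_def Ru Rv)
    moreover have "t1 x = 1" "t2 x = 1" if "t x = 1" for x
      using 3 R1[OF that] that by (simp_all add: t1_def t2_def)
    moreover have "t1 c \<le> t c \<or> t2 c \<le> t c"
    proof (rule ccontr)
      assume "\<not> ?thesis"
      then have "t c * (1 - c0) < R c - c0" "t c * c0 < t c - R c + c0"
        using 3 by (auto simp: t1_def t2_def field_simps)
      then show False by (simp add: algebra_simps)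
    qed
    ultimately show ?thesis using t1 t2 by blast
  qed
qed

end

section \<open>Compactness of the spaces of states and state-morphisms\<close>

lemma continuous_on_apply: "continuous_on X (\<lambda>t :: 'a \<Rightarrow> 'b::topological_space. t a)"
  by (rule continuous_on_subset[OF continuous_on_product_coordinates subset_UNIV])

lemma compact_imp_closed_fun:
  fixes K :: "('a \<Rightarrow> 'b::metric_space) set"
  assumes "compact K"
  shows "closed K"
proof -
  have "Hausdorff_space (product_topology (\<lambda>_::'a. euclidean :: 'b topology) UNIV)"
    by (simp add: Hausdorff_space_product_topology)
  then have "closedin (euclidean :: ('a \<Rightarrow> 'b) topology) K"
    using assms by (intro compactin_imp_closedin) (simp_all add: euclidean_product_topology)
  then show ?thesis by simp
qed

text \<open>Tychonoff's theorem, in the form \<open>compactin_PiE\<close>.\<close>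

lemma compact_unit_cube: "compact {t :: 'a \<Rightarrow> real. \<forall>x. t x \<in> {0..1}}"
proof -
  have "compactin (product_topology (\<lambda>_::'a. euclidean :: real topology) UNIV) (PiE UNIV (\<lambda>_. {0..1}))"
    by (simp add: compactin_PiE)
  moreover have "PiE UNIV (\<lambda>_. {0..1}) = {t :: 'a \<Rightarrow> real. \<forall>x. t x \<in> {0..1}}" by auto
  ultimately show ?thesis by (simp add: euclidean_product_topology)
qed

lemma compact_bosbach_states: "compact (bosbach_states arr sqg one zero)"
proof -
  have "bosbach_states arr sqg one zero =
    {t. \<forall>x. t x \<in> {0..1}} \<inter> ((\<Inter>x. \<Inter>y. {t. t x + t (arr x y) = t y + t (arr y x)}) \<inter>
    (\<Inter>x. \<Inter>y. {t. t x + t (sqg x y) = t y + t (sqg y x)}) \<inter> {t. t zero = 0} \<inter> {t. t one = 1})"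
    by (auto simp: bosbach_states_def)
  also have "compact \<dots>"
    by (intro compact_Int_closed compact_unit_cube closed_Int closed_INT ballI
        closed_Collect_eq continuous_intros continuous_on_apply)
  finally show ?thesis .
qed

lemma compact_state_morphisms: "compact (state_morphisms arr sqg zero)"
proof -
  have "state_morphisms arr sqg zero =
    {t. \<forall>x. t x \<in> {0..1}} \<inter> ((\<Inter>x. \<Inter>y. {t. t (arr x y) = min (1 - t x + t y) 1}) \<inter>
    (\<Inter>x. \<Inter>y. {t. t (sqg x y) = min (1 - t x + t y) 1}) \<inter> {t. t zero = 0})"
    by (auto simp: state_morphisms_def)
  also have "compact \<dots>"
    by (intro compact_Int_closed compact_unit_cube closed_Int closed_INT ballI
        closed_Collect_eq continuous_intros continuous_on_apply)
  finally show ?thesis .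
qed

lemma (in bounded_pseudo_bck) state_morphism_one:
  assumes "m \<in> state_morphisms arr sqg zero"
  shows "m one = 1"
proof -
  have "m one = m (arr zero zero)" using le_refl[of zero] by (simp add: le_iff_arr)
  also have "\<dots> = 1" using assms by (simp add: state_morphisms_def)
  finally show ?thesis .
qed

lemma (in bounded_pseudo_bck) state_morphisms_subset:
  "state_morphisms arr sqg zero \<subseteq> bosbach_states arr sqg one zero"
proof
  fix m assume m: "m \<in> state_morphisms arr sqg zero"
  then have "m x + min (1 - m x + m y) 1 = m y + min (1 - m y + m x) 1" for x y by auto
  then show "m \<in> bosbach_states arr sqg one zero"
    using m state_morphism_one[OF m] by (auto simp: state_morphisms_def bosbach_states_def)
qed

section \<open>State-morphisms below a state\<close>

context bosbach_state
begin

text \<open>In each case of the hypothesis the Bosbach identity yields one branch of the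
  \<open>min\<close>.\<close>

lemma state_morphismI:
  assumes "\<And>a b. t (a \<rhd> b) = 1 \<or> t (b \<rhd> a) = 1"
  shows "t \<in> state_morphisms arr sqg zero"
proof -
  have "t (a \<rhd> b) = min (1 - t a + t b) 1" for a b
    using assms[of a b] t_arr[of a b] t_le[of "a \<rhd> b"] t_le[of "b \<rhd> a"] by auto
  then show ?thesis
    by (auto simp: state_morphisms_def t_zero t_ge t_le simp flip: t_arr_eq_sqg)
qed

text \<open>The set \<open>C (a, b)\<close> collects the requirements for one pair; a state in all
  of them is a state-morphism, and compactness reduces this to finitely many pairs.\<close>

lemma ex_state_morphism_le: "\<exists>m\<in>state_morphisms arr sqg zero. m c \<le> t c"
proof -
  define C where "C = (\<lambda>(a, b). {t'. t' c \<le> t c} \<inter>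
    ({t'. t' (a \<rhd> b) = 1} \<union> {t' :: 'a \<Rightarrow> real. t' (b \<rhd> a) = 1}))"
  \<comment> \<open>One application of \<open>split\<close> per pair suffices: values equal to 1
    stay 1 and the value at \<open>c\<close> does not grow, so earlier requirements survive.\<close>
  have fin: "\<exists>t'\<in>bosbach_states arr sqg one zero. t' c \<le> t c \<and> (\<forall>p\<in>F. t' \<in> C p)"
    if "finite F" for F using that
  proof induction
    case empty
    then show ?case using state by auto
  next
    case (insert p F)
    then obtain t1 where t1: "t1 \<in> bosbach_states arr sqg one zero" "t1 c \<le> t c"
      "\<forall>p\<in>F. t1 \<in> C p" by blast
    obtain a b where p: "p = (a, b)" by force
    have "bosbach_state le arr sqg one zero t1"
      using t1(1) by unfold_locales
    then obtain t2 where t2: "t2 \<in> bosbach_states arr sqg one zero" "t2 c \<le> t1 c"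
      "\<And>x. t1 x = 1 \<Longrightarrow> t2 x = 1" "t2 (a \<rhd> b) = 1 \<or> t2 (b \<rhd> a) = 1"
      by (blast dest: bosbach_state.split[of _ _ _ _ _ _ c a b])
    have "t2 \<in> C p" using t1(2) t2(2,4) by (simp add: p C_def)
    moreover have "t2 \<in> C q" if "q \<in> F" for q
    proof -
      obtain a' b' where q: "q = (a', b')" by force
      have "t1 \<in> C q" using t1(3) that by blast
      then show ?thesis using t2(2) t2(3)[of "a' \<rhd> b'"] t2(3)[of "b' \<rhd> a'"] by (auto simp: q C_def)
    qed
    ultimately show ?case using t1(2) t2(1,2) by (intro bexI[of _ t2]) auto
  qed
  have "bosbach_states arr sqg one zero \<inter> (\<Inter>p\<in>UNIV. C p) \<noteq> {}"
  proof (rule compact_imp_fip_image[OF compact_bosbach_states])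
    show "closed (C p)" for p
      unfolding C_def case_prod_beta
      by (intro closed_Int closed_Un closed_Collect_eq closed_Collect_le continuous_intros
          continuous_on_apply)
    show "bosbach_states arr sqg one zero \<inter> (\<Inter>p\<in>F. C p) \<noteq> {}" if "finite F" for F
      using fin[OF that] by blast
  qed
  then obtain m where m: "m \<in> bosbach_states arr sqg one zero" "\<And>a b. m \<in> C (a, b)" by blast
  have "bosbach_state le arr sqg one zero m"
    using m(1) by unfold_locales
  then have "m \<in> state_morphisms arr sqg zero"
    by (rule bosbach_state.state_morphismI) (use m(2) in \<open>auto simp: C_def\<close>)
  then show ?thesis using m(2) by (auto simp: C_def)
qed

text \<open>Every state-morphism is 1 at \<open>a \<rhd> b\<close>, and some state-morphism lies
  below \<open>t\<close> there.\<close>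

lemma state_mono_of_morphisms:
  assumes "\<And>m. m \<in> state_morphisms arr sqg zero \<Longrightarrow> m a \<le> m b"
  shows "t a \<le> t b"
proof -
  obtain m where m: "m \<in> state_morphisms arr sqg zero" "m (a \<rhd> b) \<le> t (a \<rhd> b)"
    using ex_state_morphism_le by blast
  moreover have "m (a \<rhd> b) = 1"
    using m(1) assms[OF m(1)] by (simp add: state_morphisms_def)
  ultimately have "t (a \<rhd> b) = 1" using t_le[of "a \<rhd> b"] by simp
  then show ?thesis by (rule t_mp)
qed

text \<open>\<open>c\<close> induces the same function as the truncated sum
  \<open>(a \<rhd> zero) \<rhd> b\<close>. As nothing is truncated,
  \<open>b \<rhd> (a \<rhd> zero)\<close> has value 1, and the Bosbach identity for \<open>b\<close>
  and \<open>a \<rhd> zero\<close> gives the claim.\<close>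

lemma state_additive_of_morphisms:
  assumes "\<And>m. m \<in> state_morphisms arr sqg zero \<Longrightarrow> m c = m a + m b"
  shows "t c = t a + t b"
proof -
  have mor: "m zero = 0" "m (x \<rhd> y) = min (1 - m x + m y) 1" "m x \<in> {0..1}"
    if "m \<in> state_morphisms arr sqg zero" for m x y
    using that by (auto simp: state_morphisms_def)
  have neg: "t (x \<rhd> zero) = 1 - t x" for x
    using t_arr_below[OF zero_le, of x] by (simp add: t_zero)
  have "t c = t ((a \<rhd> zero) \<rhd> b)"
  proof (intro antisym state_mono_of_morphisms)
    fix m assume m: "m \<in> state_morphisms arr sqg zero"
    have "m ((a \<rhd> zero) \<rhd> b) = m c"
      using mor(3)[OF m, of a] mor(3)[OF m, of c] by (simp add: mor(1,2)[OF m] assms[OF m])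
    then show "m c \<le> m ((a \<rhd> zero) \<rhd> b)" "m ((a \<rhd> zero) \<rhd> b) \<le> m c" by simp_all
  qed
  moreover have "t (b \<rhd> (a \<rhd> zero)) = t one"
  proof (intro antisym state_mono_of_morphisms)
    fix m assume m: "m \<in> state_morphisms arr sqg zero"
    then have "m a + m b \<le> 1" using assms[OF m] mor(3)[OF m, of c] by simp
    then show "m (b \<rhd> (a \<rhd> zero)) \<le> m one" "m one \<le> m (b \<rhd> (a \<rhd> zero))"
      using mor(3)[OF m, of a] by (simp_all add: mor(1,2)[OF m] state_morphism_one[OF m])
  qed
  ultimately show ?thesis
    using t_arr[of b "a \<rhd> zero"] by (simp add: neg t_one)
qed

end

subsection \<open>States on separating MV-algebras of continuous functions\<close>

text \<open>Addition with carry, for \<open>p\<close> the value of an element and \<open>q\<close>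
  that of its multiple: the first two parts give the new slice \<open>k + 1\<close> and the carry it
  passes on, the third gives slice 0, into which \<open>p\<close> itself enters.\<close>

lemma slice_step:
  fixes p q k :: real
  assumes "0 \<le> p" "p \<le> 1"
  shows "min (max 0 (min 1 (q - (1 + k))) + max (p + max 0 (min 1 (q - k)) - 1) 0) 1 =
      max 0 (min 1 (q + p - (1 + k)))"
    and "max (max 0 (min 1 (q - (1 + k))) + max (p + max 0 (min 1 (q - k)) - 1) 0 - 1) 0 =
      max (p + max 0 (min 1 (q - (1 + k))) - 1) 0"
    and "0 \<le> q \<Longrightarrow> min (max 0 (min 1 q) + p) 1 = max 0 (min 1 (q + p))"
  using assms by (auto simp: min_def max_def)

text \<open>The functions are named by indices and compared only on \<open>S\<close>, so distinct
  indices may induce the same function; \<open>mono\<close> makes \<open>s\<close> depend on that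
  function alone. The ambient space need not be Hausdorff, whence \<open>closed_S\<close> beside
  \<open>compact_S\<close>.\<close>

locale mv_state =
  fixes S :: "'b::topological_space set" and \<phi> :: "'i \<Rightarrow> 'b \<Rightarrow> real" and s :: "'i \<Rightarrow> real"
  assumes compact_S: "compact S" and closed_S: "closed S"
    and cont: "continuous_on UNIV (\<phi> a)"
    and range01: "x \<in> S \<Longrightarrow> 0 \<le> \<phi> a x \<and> \<phi> a x \<le> 1"
    and separating: "x \<in> S \<Longrightarrow> y \<in> S \<Longrightarrow> x \<noteq> y \<Longrightarrow> \<exists>a. \<phi> a x \<noteq> \<phi> a y"
    and neg_ex: "\<exists>b. \<forall>x\<in>S. \<phi> b x = 1 - \<phi> a x"
    and sum_ex: "\<exists>c. \<forall>x\<in>S. \<phi> c x = min (\<phi> a x + \<phi> b x) 1"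
    and mono: "(\<And>x. x \<in> S \<Longrightarrow> \<phi> a x \<le> \<phi> b x) \<Longrightarrow> s a \<le> s b"
    and additive: "(\<And>x. x \<in> S \<Longrightarrow> \<phi> c x = \<phi> a x + \<phi> b x) \<Longrightarrow> s c = s a + s b"
    and unit: "(\<And>x. x \<in> S \<Longrightarrow> \<phi> a x = 1) \<Longrightarrow> s a = 1"
begin

section \<open>MV operations and good sequences\<close>

lemma prod_ex: "\<exists>c. \<forall>x\<in>S. \<phi> c x = max (\<phi> a x + \<phi> b x - 1) 0"
proof -
  obtain na where na: "\<forall>x\<in>S. \<phi> na x = 1 - \<phi> a x" using neg_ex by blast
  obtain nb where nb: "\<forall>x\<in>S. \<phi> nb x = 1 - \<phi> b x" using neg_ex by blast
  obtain c where c: "\<forall>x\<in>S. \<phi> c x = min (\<phi> na x + \<phi> nb x) 1" using sum_ex by blast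
  obtain d where d: "\<forall>x\<in>S. \<phi> d x = 1 - \<phi> c x" using neg_ex by blast
  show ?thesis by (intro exI[of _ d]) (auto simp: na nb c d)
qed

lemma diff_ex: "\<exists>c. \<forall>x\<in>S. \<phi> c x = max (\<phi> a x - \<phi> b x) 0"
proof -
  obtain nb where nb: "\<forall>x\<in>S. \<phi> nb x = 1 - \<phi> b x" using neg_ex by blast
  obtain c where c: "\<forall>x\<in>S. \<phi> c x = max (\<phi> a x + \<phi> nb x - 1) 0" using prod_ex by blast
  show ?thesis by (intro exI[of _ c]) (auto simp: nb c)
qed

lemma min_ex: "\<exists>c. \<forall>x\<in>S. \<phi> c x = min (\<phi> a x) (\<phi> b x)"
proof -
  obtain d where d: "\<forall>x\<in>S. \<phi> d x = max (\<phi> a x - \<phi> b x) 0" using diff_ex by blast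
  obtain c where c: "\<forall>x\<in>S. \<phi> c x = max (\<phi> a x - \<phi> d x) 0" using diff_ex by blast
  have "\<phi> c x = min (\<phi> a x) (\<phi> b x)" if "x \<in> S" for x
    using that c d range01[OF that, of a] range01[OF that, of b] by auto
  then show ?thesis by blast
qed

lemma zero_ex: "\<exists>c. \<forall>x\<in>S. \<phi> c x = 0"
proof -
  fix a
  obtain c where "\<forall>x\<in>S. \<phi> c x = max (\<phi> a x - \<phi> a x) 0" using diff_ex by blast
  then show ?thesis by (intro exI[of _ c]) auto
qed

lemma one_ex: "\<exists>c. \<forall>x\<in>S. \<phi> c x = 1"
proof -
  obtain c where "\<forall>x\<in>S. \<phi> c x = 0" using zero_ex by blast
  then show ?thesis using neg_ex[of c] by auto
qed

lemma s_zero: "(\<And>x. x \<in> S \<Longrightarrow> \<phi> a x = 0) \<Longrightarrow> s a = 0"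
  using additive[of a a a] by simp

lemma s_nonneg: "0 \<le> s a"
proof -
  obtain c where c: "\<forall>x\<in>S. \<phi> c x = 0" using zero_ex by blast
  then have "s c \<le> s a" using range01 by (intro mono) auto
  then show ?thesis using s_zero[of c] c by simp
qed

lemma s_le_one: "s a \<le> 1"
proof -
  obtain c where c: "\<forall>x\<in>S. \<phi> c x = 1" using one_ex by blast
  then have "s a \<le> s c" using range01 by (intro mono) auto
  then show ?thesis using unit[of c] c by simp
qed

lemma s_neg:
  assumes "\<And>x. x \<in> S \<Longrightarrow> \<phi> b x = 1 - \<phi> a x"
  shows "s b = 1 - s a"
proof -
  obtain c where c: "\<forall>x\<in>S. \<phi> c x = 1" using one_ex by blast
  then have "s c = s a + s b" using assms by (intro additive) auto
  then show ?thesis using unit[of c] c by simp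
qed

text \<open>Once the overflow \<open>d\<close> is removed from \<open>b\<close>, the rest
  \<open>e\<close> fits on top of \<open>a\<close> without truncation, so plain additivity applies
  twice.\<close>

lemma s_modular:
  assumes c: "\<And>x. x \<in> S \<Longrightarrow> \<phi> c x = min (\<phi> a x + \<phi> b x) 1"
    and d: "\<And>x. x \<in> S \<Longrightarrow> \<phi> d x = max (\<phi> a x + \<phi> b x - 1) 0"
  shows "s c + s d = s a + s b"
proof -
  obtain e where e: "\<forall>x\<in>S. \<phi> e x = max (\<phi> b x - \<phi> d x) 0" using diff_ex by blast
  have e': "\<phi> e x = \<phi> b x - \<phi> d x" if "x \<in> S" for x
    using that e d[OF that] range01[OF that, of a] range01[OF that, of b] by auto
  have "s b = s e + s d" by (rule additive) (simp add: e')
  moreover have "s c = s a + s e" by (rule additive) (use e' c d in auto)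
  ultimately show ?thesis by simp
qed

text \<open>The good sequence of the multiple \<open>n * a\<close>, in which \<open>g k\<close> represents the truncation of
  \<open>n * \<phi> a - k\<close> to the unit interval.\<close>

lemma multiple_slices:
  "\<exists>g. (\<forall>k. \<forall>x\<in>S. \<phi> (g k) x = max 0 (min 1 (real n * \<phi> a x - real k))) \<and>
    real n * s a = (\<Sum>k<n. s (g k))"
proof (induction n)
  case 0
  obtain c where "\<forall>x\<in>S. \<phi> c x = 0" using zero_ex by blast
  then show ?case by (intro exI[of _ "\<lambda>_. c"]) auto
next
  case (Suc n)
  then obtain g where g: "\<And>k x. x \<in> S \<Longrightarrow> \<phi> (g k) x = max 0 (min 1 (real n * \<phi> a x - real k))"
    and gs: "real n * s a = (\<Sum>k<n. s (g k))" by blast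
  have "\<forall>k. \<exists>c. \<forall>x\<in>S. \<phi> c x = max (\<phi> a x + \<phi> (g k) x - 1) 0" using prod_ex by blast
  then obtain p where p: "\<And>k x. x \<in> S \<Longrightarrow> \<phi> (p k) x = max (\<phi> a x + \<phi> (g k) x - 1) 0"
    by metis
  \<comment> \<open>\<open>h k\<close> is the carry into slice \<open>k\<close>: \<open>a\<close>
    enters at slice 0, and \<open>p j\<close> is the overflow of slice \<open>j\<close>.\<close>
  define h where "h = (\<lambda>k. case k of 0 \<Rightarrow> a | Suc j \<Rightarrow> p j)"
  have "\<forall>k. \<exists>c. \<forall>x\<in>S. \<phi> c x = min (\<phi> (g k) x + \<phi> (h k) x) 1" using sum_ex by blast
  then obtain g' where g': "\<And>k x. x \<in> S \<Longrightarrow> \<phi> (g' k) x = min (\<phi> (g k) x + \<phi> (h k) x) 1"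
    by metis
  have *: "\<phi> (g' k) x = max 0 (min 1 (real (Suc n) * \<phi> a x - real k)) \<and>
      \<phi> (h (Suc k)) x = max (\<phi> (g k) x + \<phi> (h k) x - 1) 0" if x: "x \<in> S" for k x
  proof -
    define q where "q = real n * \<phi> a x"
    have q: "real (Suc n) * \<phi> a x = q + \<phi> a x" by (simp add: q_def algebra_simps)
    have gq: "\<phi> (g k) x = max 0 (min 1 (q - real k))" for k using g[OF x] by (simp add: q_def)
    have a: "0 \<le> \<phi> a x" "\<phi> a x \<le> 1" using range01[OF x, of a] by simp_all
    have "0 \<le> q" unfolding q_def using a by simp
    show ?thesis
    proof (cases k)
      case 0
      then show ?thesis
        unfolding q g'[OF x] using slice_step(3)[OF a \<open>0 \<le> q\<close>]
        by (simp add: h_def p[OF x] gq add.commute[of "\<phi> a x"])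
    next
      case (Suc j)
      then show ?thesis
        unfolding q g'[OF x] using slice_step(1,2)[OF a, of q "real j"]
        by (simp only: h_def nat.case p[OF x] gq of_nat_Suc add.commute[of _ "1::real"])
    qed
  qed
  have step: "s (g' k) = s (g k) + (s (h k) - s (h (Suc k)))" for k
    using s_modular[OF g' conjunct2[OF *], of k] by simp
  \<comment> \<open>\<open>n * \<phi> a\<close> never exceeds \<open>n\<close> on \<open>S\<close>,
    so slice \<open>n\<close> is empty and passes on no carry.\<close>
  have zero: "s (g n) = 0" "s (h (Suc n)) = 0"
  proof -
    have *: "\<phi> (g n) x = 0" if "x \<in> S" for x
      using g[OF that] range01[OF that, of a] mult_left_le[of "\<phi> a x" "real n"] by auto
    then show "s (g n) = 0" by (rule s_zero)
    show "s (h (Suc n)) = 0"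
      by (rule s_zero) (use * p range01 in \<open>simp add: h_def\<close>)
  qed
  have "(\<Sum>k<Suc n. s (g' k)) = (\<Sum>k<Suc n. s (g k)) + (\<Sum>k<Suc n. s (h k) - s (h (Suc k)))"
    by (simp only: step sum.distrib)
  \<comment> \<open>The carries telescope to the \<open>a\<close> that entered at slice 0.\<close>
  also have "(\<Sum>k<Suc n. s (h k) - s (h (Suc k))) = s a"
    using sum_lessThan_telescope'[of "\<lambda>k. s (h k)" "Suc n"] unfolding zero(2) by (simp only: h_def nat.case diff_zero)
  finally have "real (Suc n) * s a = (\<Sum>k<Suc n. s (g' k))"
    by (simp add: zero gs[symmetric] algebra_simps)
  then show ?case using * by blast
qed

section \<open>Urysohn separation within the algebra\<close>

text \<open>The values 1 and 0 are required on open neighbourhoods, so that separation from a point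
  extends to a neighbourhood of it and finite subcovers can be used.\<close>

definition separated :: "'b set \<Rightarrow> 'b set \<Rightarrow> bool" where
  "separated A B \<longleftrightarrow> (\<exists>b P Q. open P \<and> open Q \<and> A \<subseteq> P \<and> B \<subseteq> Q \<and>
    (\<forall>x\<in>S \<inter> P. \<phi> b x = 1) \<and> (\<forall>x\<in>S \<inter> Q. \<phi> b x = 0))"

lemma separatedI:
  assumes "open P" "open Q" "A \<subseteq> P" "B \<subseteq> Q"
    and "\<And>x. x \<in> S \<Longrightarrow> x \<in> P \<Longrightarrow> \<phi> b x = 1" "\<And>x. x \<in> S \<Longrightarrow> x \<in> Q \<Longrightarrow> \<phi> b x = 0"
  shows "separated A B"
  unfolding separated_def using assms
  by (intro exI[of _ b] exI[of _ P] exI[of _ Q] conjI ballI) auto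

lemma separatedE:
  assumes "separated A B"
  obtains b P Q where "open P" "open Q" "A \<subseteq> P" "B \<subseteq> Q"
    "\<And>x. x \<in> S \<Longrightarrow> x \<in> P \<Longrightarrow> \<phi> b x = 1" "\<And>x. x \<in> S \<Longrightarrow> x \<in> Q \<Longrightarrow> \<phi> b x = 0"
proof -
  from assms obtain b P Q where "open P \<and> open Q \<and> A \<subseteq> P \<and> B \<subseteq> Q \<and>
    (\<forall>x\<in>S \<inter> P. \<phi> b x = 1) \<and> (\<forall>x\<in>S \<inter> Q. \<phi> b x = 0)"
    unfolding separated_def by (elim exE)
  then show thesis by (intro that[of P Q b]) auto
qed

lemma separated_sym:
  assumes "separated A B"
  shows "separated B A"
  using assms
proof (rule separatedE)
  fix b P Q
  assume b: "open P" "open Q" "A \<subseteq> P" "B \<subseteq> Q"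
    "\<And>x. x \<in> S \<Longrightarrow> x \<in> P \<Longrightarrow> \<phi> b x = 1" "\<And>x. x \<in> S \<Longrightarrow> x \<in> Q \<Longrightarrow> \<phi> b x = 0"
  obtain c where c: "\<forall>x\<in>S. \<phi> c x = 1 - \<phi> b x" using neg_ex by blast
  show ?thesis by (rule separatedI[of Q P _ _ c]) (use b c in auto)
qed

lemma separated_Un:
  assumes "separated A B" "separated A B'"
  shows "separated A (B \<union> B')"
proof -
  obtain b P Q where b: "open P" "open Q" "A \<subseteq> P" "B \<subseteq> Q"
    "\<And>x. x \<in> S \<Longrightarrow> x \<in> P \<Longrightarrow> \<phi> b x = 1" "\<And>x. x \<in> S \<Longrightarrow> x \<in> Q \<Longrightarrow> \<phi> b x = 0"
    by (rule separatedE[OF assms(1)]) (rule that)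
  obtain b' P' Q' where b': "open P'" "open Q'" "A \<subseteq> P'" "B' \<subseteq> Q'"
    "\<And>x. x \<in> S \<Longrightarrow> x \<in> P' \<Longrightarrow> \<phi> b' x = 1" "\<And>x. x \<in> S \<Longrightarrow> x \<in> Q' \<Longrightarrow> \<phi> b' x = 0"
    by (rule separatedE[OF assms(2)]) (rule that)
  obtain c where c: "\<forall>x\<in>S. \<phi> c x = min (\<phi> b x) (\<phi> b' x)" using min_ex by blast
  show ?thesis
  proof (rule separatedI[of "P \<inter> P'" "Q \<union> Q'" _ _ c])
    fix x assume x: "x \<in> S"
    show "\<phi> c x = 1" if "x \<in> P \<inter> P'" using that x b(5) b'(5) c by simp
    show "\<phi> c x = 0" if "x \<in> Q \<union> Q'"
      using that x b(6) b'(6) c range01[OF x, of b] range01[OF x, of b'] by auto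
  qed (use b b' in auto)
qed

text \<open>Each point of \<open>K\<close> has an open neighbourhood separated from
  \<open>A\<close>; finitely many cover \<open>K\<close>, and \<open>separated_Un\<close> joins
  them.\<close>

lemma separated_compact:
  assumes "compact K" and pt: "\<And>y. y \<in> K \<Longrightarrow> separated A {y}"
  shows "separated A K"
proof -
  define \<Q> where "\<Q> = {Q. open Q \<and> separated A Q}"
  have "\<exists>Q\<in>\<Q>. y \<in> Q" if "y \<in> K" for y
    using pt[OF that]
  proof (rule separatedE)
    fix b P Q
    assume b: "open P" "open Q" "A \<subseteq> P" "{y} \<subseteq> Q"
      "\<And>x. x \<in> S \<Longrightarrow> x \<in> P \<Longrightarrow> \<phi> b x = 1" "\<And>x. x \<in> S \<Longrightarrow> x \<in> Q \<Longrightarrow> \<phi> b x = 0"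
    have "separated A Q" by (rule separatedI[of P Q _ _ b]) (use b in auto)
    then show ?thesis using b by (auto simp: \<Q>_def)
  qed
  then have "K \<subseteq> \<Union>\<Q>" by blast
  moreover have "\<And>Q. Q \<in> \<Q> \<Longrightarrow> open Q" by (simp add: \<Q>_def)
  ultimately obtain F where F: "F \<subseteq> \<Q>" "finite F" "K \<subseteq> \<Union>F"
    using compactE[OF assms(1)] by metis
  obtain c where c: "\<forall>x\<in>S. \<phi> c x = 1" using one_ex by blast
  have "separated A (\<Union>F)"
    using F(2,1)
  proof induction
    case empty
    show ?case by (rule separatedI[of UNIV "{}" _ _ c]) (use c in auto)
  next
    case (insert Q F)
    then have "separated A Q" "separated A (\<Union>F)" by (simp_all add: \<Q>_def)
    then show ?case by (simp add: separated_Un)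
  qed
  then show ?thesis
  proof (rule separatedE)
    fix b P Q
    assume b: "open P" "open Q" "A \<subseteq> P" "\<Union>F \<subseteq> Q"
      "\<And>x. x \<in> S \<Longrightarrow> x \<in> P \<Longrightarrow> \<phi> b x = 1" "\<And>x. x \<in> S \<Longrightarrow> x \<in> Q \<Longrightarrow> \<phi> b x = 0"
    show ?thesis by (rule separatedI[of P Q _ _ b]) (use b F(3) in auto)
  qed
qed

lemma separated_points:
  assumes "x \<in> S" "y \<in> S" "x \<noteq> y"
  shows "separated {x} {y}"
proof -
  have *: "separated {x} {y}" if less: "\<phi> a y < \<phi> a x" and y: "y \<in> S" for a x y
  proof -
    obtain n where "2 / (\<phi> a x - \<phi> a y) < real n" using reals_Archimedean2 by blast
    then have n: "real n * \<phi> a y + 2 < real n * \<phi> a x"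
      using less by (simp add: field_simps)
    \<comment> \<open>The least integer strictly above \<open>real n * \<phi> a y\<close>; the gap
      of more than 2 keeps \<open>k + 1\<close> below \<open>real n * \<phi> a x\<close>. So slice
      \<open>k\<close> is 0 near \<open>y\<close> and 1 near \<open>x\<close>.\<close>
    define k where "k = nat \<lfloor>real n * \<phi> a y\<rfloor> + 1"
    have "0 \<le> real n * \<phi> a y" using range01[OF y, of a] by simp
    then have k: "real n * \<phi> a y < real k" "real k \<le> real n * \<phi> a y + 1"
      unfolding k_def by (auto simp: of_nat_nat) linarith
    obtain g where g: "\<forall>k. \<forall>x\<in>S. \<phi> (g k) x = max 0 (min 1 (real n * \<phi> a x - real k))"
      using multiple_slices by blast
    show ?thesis
    proof (rule separatedI[of "{z. real k + 1 < real n * \<phi> a z}" "{z. real n * \<phi> a z < real k}" _ _ "g k"])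
      show "open {z. real k + 1 < real n * \<phi> a z}" "open {z. real n * \<phi> a z < real k}"
        by (intro open_Collect_less continuous_intros cont)+
      fix z assume "z \<in> S"
      then have gz: "\<phi> (g k) z = max 0 (min 1 (real n * \<phi> a z - real k))" using g by blast
      show "\<phi> (g k) z = 1" if "z \<in> {z. real k + 1 < real n * \<phi> a z}" using gz that by auto
      show "\<phi> (g k) z = 0" if "z \<in> {z. real n * \<phi> a z < real k}" using gz that by auto
    qed (use n k in auto)
  qed
  obtain a where "\<phi> a x \<noteq> \<phi> a y" using separating assms by blast
  then show ?thesis
    using *[of a y x] *[of a x y] assms separated_sym by (meson linorder_neqE)
qed

lemma separated_disjoint_compacts:
  assumes "compact K" "compact L" "K \<subseteq> S" "L \<subseteq> S" "K \<inter> L = {}"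
  shows "separated K L"
proof (rule separated_compact[OF assms(2)])
  fix y assume y: "y \<in> L"
  have "separated {y} K"
    by (rule separated_compact[OF assms(1)], rule separated_points) (use assms y in auto)
  then show "separated K {y}" by (rule separated_sym)
qed


section \<open>The Riesz content of open sets\<close>

text \<open>On the subspace \<open>S\<close>, the function \<open>\<phi> a\<close> has compact support inside \<open>U\<close>.\<close>

definition supported :: "'i \<Rightarrow> 'b set \<Rightarrow> bool" where
  "supported a U \<longleftrightarrow> (\<exists>P. open P \<and> S - U \<subseteq> P \<and> (\<forall>x\<in>S \<inter> P. \<phi> a x = 0))"

text \<open>The value given to an open set in the Riesz construction, with elements of the algebra
  as test functions.\<close>

definition inner_content :: "'b set \<Rightarrow> ennreal" where
  "inner_content U = (SUP a\<in>{a. supported a U}. ennreal (s a))"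

lemma supportedI:
  "open P \<Longrightarrow> S - U \<subseteq> P \<Longrightarrow> (\<And>x. x \<in> S \<Longrightarrow> x \<in> P \<Longrightarrow> \<phi> a x = 0) \<Longrightarrow> supported a U"
  unfolding supported_def by (rule exI[of _ P]) auto

lemma supported_mono: "supported a U \<Longrightarrow> U \<subseteq> V \<Longrightarrow> supported a V"
  unfolding supported_def by blast

lemma inner_content_mono: "U \<subseteq> V \<Longrightarrow> inner_content U \<le> inner_content V"
  unfolding inner_content_def by (intro SUP_subset_mono) (auto intro: supported_mono)

lemma inner_content_upper: "supported a U \<Longrightarrow> ennreal (s a) \<le> inner_content U"
  unfolding inner_content_def by (intro SUP_upper) simp

lemma inner_content_least: "(\<And>a. supported a U \<Longrightarrow> ennreal (s a) \<le> c) \<Longrightarrow> inner_content U \<le> c"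
  unfolding inner_content_def by (intro SUP_least) simp

lemma supported_ex: "\<exists>a. supported a U"
proof -
  obtain c where "\<forall>x\<in>S. \<phi> c x = 0" using zero_ex by blast
  then have "supported c U" by (intro supportedI[of UNIV]) auto
  then show ?thesis by blast
qed

lemma inner_content_disjoint: "U \<inter> S = {} \<Longrightarrow> inner_content U = 0"
proof -
  assume U: "U \<inter> S = {}"
  have "inner_content U \<le> 0"
  proof (rule inner_content_least)
    fix a assume "supported a U"
    then have "\<phi> a x = 0" if "x \<in> S" for x
      using that U unfolding supported_def by blast
    then show "ennreal (s a) \<le> 0" by (simp add: s_zero)
  qed
  then show ?thesis by simp
qed

lemma inner_content_UNIV: "inner_content UNIV = 1"
proof (rule antisym)
  show "inner_content UNIV \<le> 1" by (rule inner_content_least) (simp add: s_le_one)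
  obtain c where c: "\<forall>x\<in>S. \<phi> c x = 1" using one_ex by blast
  have "supported c UNIV" by (rule supportedI[of "{}"]) auto
  then show "1 \<le> inner_content UNIV" using inner_content_upper[of c UNIV] unit[of c] c by simp
qed

text \<open>Urysohn separation splits an element supported in \<open>U \<union> V\<close> into parts supported in \<open>U\<close> and \<open>V\<close>.\<close>

lemma inner_content_Un:
  assumes "open U" "open V"
  shows "inner_content (U \<union> V) \<le> inner_content U + inner_content V"
proof (rule inner_content_least)
  fix a assume "supported a (U \<union> V)"
  then obtain P where P: "open P" "S - (U \<union> V) \<subseteq> P" "\<And>x. x \<in> S \<Longrightarrow> x \<in> P \<Longrightarrow> \<phi> a x = 0"
    unfolding supported_def by blast
  \<comment> \<open>Points of \<open>S\<close> outside \<open>P\<close> and \<open>V\<close> lie in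
    \<open>U\<close>, so these compacts are disjoint. The parts of \<open>a\<close> are its minimum
    with \<open>b\<close> and the remainder.\<close>
  have "separated (S \<inter> - (P \<union> V)) (S \<inter> - U)"
    by (rule separated_disjoint_compacts)
      (use P assms in \<open>auto intro!: compact_Int_closed compact_S\<close>)
  then obtain b Q R where b: "open Q" "open R" "S \<inter> - (P \<union> V) \<subseteq> Q" "S \<inter> - U \<subseteq> R"
    "\<And>x. x \<in> S \<Longrightarrow> x \<in> Q \<Longrightarrow> \<phi> b x = 1" "\<And>x. x \<in> S \<Longrightarrow> x \<in> R \<Longrightarrow> \<phi> b x = 0"
    by (rule separatedE) (rule that)
  obtain c where c: "\<forall>x\<in>S. \<phi> c x = min (\<phi> a x) (\<phi> b x)" using min_ex by blast
  obtain d where d: "\<forall>x\<in>S. \<phi> d x = max (\<phi> a x - \<phi> b x) 0" using diff_ex by blast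
  have "s a = s c + s d" by (rule additive) (use c d in auto)
  moreover have "supported c U"
  proof (rule supportedI[OF b(2)])
    show "\<phi> c x = 0" if "x \<in> S" "x \<in> R" for x
      using b(6)[OF that] c range01[OF that(1), of a] that(1) by auto
  qed (use b in auto)
  moreover have "supported d V"
  proof (rule supportedI[OF open_Un[OF P(1) b(1)]])
    show "\<phi> d x = 0" if "x \<in> S" "x \<in> P \<union> Q" for x
      using b(5) P(3) d range01[OF that(1), of a] range01[OF that(1), of b] that by auto
  qed (use b in auto)
  ultimately show "ennreal (s a) \<le> inner_content U + inner_content V"
    using inner_content_upper by (simp add: ennreal_plus s_nonneg add_mono)
qed

lemma inner_content_finite_Union:
  assumes "finite F" "\<And>i. i \<in> F \<Longrightarrow> open (U i)"
  shows "inner_content (\<Union>i\<in>F. U i) \<le> (\<Sum>i\<in>F. inner_content (U i))"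
  using assms
proof (induction F)
  case (insert i F)
  have "inner_content (\<Union>j\<in>insert i F. U j) \<le> inner_content (U i) + inner_content (\<Union>j\<in>F. U j)"
    using insert.prems by (simp add: inner_content_Un open_UN)
  also have "\<dots> \<le> inner_content (U i) + (\<Sum>j\<in>F. inner_content (U j))"
    using insert by (intro add_left_mono) auto
  finally show ?case using insert by simp
qed (simp add: inner_content_disjoint)

text \<open>The complement of \<open>P\<close> in \<open>S\<close> is compact, so an element
  supported in the union is already supported in a finite subunion.\<close>

lemma inner_content_countable_Union:
  fixes U :: "nat \<Rightarrow> 'b set"
  assumes "\<And>i. open (U i)"
  shows "inner_content (\<Union>i. U i) \<le> (\<Sum>i. inner_content (U i))"
proof (rule inner_content_least)
  fix a assume "supported a (\<Union>i. U i)"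
  then obtain P where P: "open P" "S - (\<Union>i. U i) \<subseteq> P" "\<And>x. x \<in> S \<Longrightarrow> x \<in> P \<Longrightarrow> \<phi> a x = 0"
    unfolding supported_def by blast
  have K: "compact (S \<inter> - P)" using P(1) by (intro compact_Int_closed compact_S) auto
  have "S \<inter> - P \<subseteq> (\<Union>i\<in>UNIV. U i)" using P(2) by auto
  then obtain F where F: "finite F" "S \<inter> - P \<subseteq> (\<Union>i\<in>F. U i)"
    using compactE_image[OF K, of UNIV U] assms by metis
  have "supported a (\<Union>i\<in>F. U i)"
    by (rule supportedI[OF P(1) _ P(3)]) (use F in auto)
  then have "ennreal (s a) \<le> inner_content (\<Union>i\<in>F. U i)" by (rule inner_content_upper)
  also have "\<dots> \<le> (\<Sum>i\<in>F. inner_content (U i))" by (rule inner_content_finite_Union[OF F(1) assms])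
  also have "\<dots> \<le> (\<Sum>i. inner_content (U i))" by (intro sum_le_suminf F(1)) auto
  finally show "ennreal (s a) \<le> (\<Sum>i. inner_content (U i))" .
qed

text \<open>Take \<open>C = S - P\<close> for an open \<open>P\<close> on which
  \<open>\<phi> a\<close> vanishes within \<open>S\<close>. An element supported in
  \<open>V - C\<close> vanishes wherever \<open>\<phi> a\<close> does not, so its sum with
  \<open>a\<close> is untruncated and supported in \<open>V\<close>.\<close>

lemma inner_content_split:
  assumes a: "supported a (U \<inter> V)"
  shows "\<exists>C. closed C \<and> C \<subseteq> U \<inter> V \<and> ennreal (s a) + inner_content (V - C) \<le> inner_content V"
proof -
  obtain P where P: "open P" "S - (U \<inter> V) \<subseteq> P" "\<And>x. x \<in> S \<Longrightarrow> x \<in> P \<Longrightarrow> \<phi> a x = 0"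
    using a unfolding supported_def by blast
  have "ennreal (s a) + inner_content (V - (S - P)) = (SUP b\<in>{b. supported b (V - (S - P))}. ennreal (s a) + ennreal (s b))"
    unfolding inner_content_def using supported_ex by (subst ennreal_SUP_add_right) auto
  also have "\<dots> \<le> inner_content V"
  proof (rule SUP_least, unfold mem_Collect_eq)
    fix b assume "supported b (V - (S - P))"
    then obtain Q where Q: "open Q" "S - (V - (S - P)) \<subseteq> Q" "\<And>x. x \<in> S \<Longrightarrow> x \<in> Q \<Longrightarrow> \<phi> b x = 0"
      unfolding supported_def by blast
    obtain c where c: "\<forall>x\<in>S. \<phi> c x = min (\<phi> a x + \<phi> b x) 1" using sum_ex by blast
    have "\<phi> c x = \<phi> a x + \<phi> b x" if x: "x \<in> S" for x
    proof (cases "x \<in> P")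
      case True
      then show ?thesis using P(3)[OF x] c x range01[OF x, of b] by simp
    next
      case False
      then have "x \<in> Q" using x Q(2) by auto
      then show ?thesis using Q(3)[OF x] c x range01[OF x, of a] by simp
    qed
    then have "s c = s a + s b" by (rule additive)
    moreover have "supported c V"
    proof (rule supportedI[OF open_Int[OF P(1) Q(1)]])
      show "S - V \<subseteq> P \<inter> Q" using P(2) Q(2) by auto
      show "\<phi> c x = 0" if "x \<in> S" "x \<in> P \<inter> Q" for x using P(3) Q(3) that c by simp
    qed
    ultimately show "ennreal (s a) + ennreal (s b) \<le> inner_content V"
      using inner_content_upper[of c V] by (simp add: ennreal_plus s_nonneg)
  qed
  finally show ?thesis
    using P(1,2) closed_S by (intro exI[of _ "S - P"]) auto
qed

section \<open>Caratheodory extension to a regular Borel measure\<close>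

definition outer :: "'b set \<Rightarrow> ennreal" where
  "outer E = (INF U\<in>{U. open U \<and> E \<subseteq> U}. inner_content U)"

lemma outer_open: "open U \<Longrightarrow> outer U = inner_content U"
  unfolding outer_def by (intro antisym INF_greatest INF_lower) (auto intro: inner_content_mono)

lemma outer_le: "open U \<Longrightarrow> E \<subseteq> U \<Longrightarrow> outer E \<le> inner_content U"
  unfolding outer_def by (intro INF_lower) auto

lemma outer_greatest: "(\<And>U. open U \<Longrightarrow> E \<subseteq> U \<Longrightarrow> c \<le> inner_content U) \<Longrightarrow> c \<le> outer E"
  unfolding outer_def by (intro INF_greatest) auto

lemma outer_mono: "E \<subseteq> F \<Longrightarrow> outer E \<le> outer F"
  by (rule outer_greatest) (auto intro: outer_le)

lemma outer_approx:
  assumes "outer E < c"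
  shows "\<exists>U. open U \<and> E \<subseteq> U \<and> inner_content U < c"
  using assms unfolding outer_def INF_less_iff by auto

lemma outer_countably_subadditive: "outer (\<Union>i. A i) \<le> (\<Sum>i. outer (A i))" for A :: "nat \<Rightarrow> 'b set"
proof (rule ennreal_le_epsilon)
  fix e :: real assume e: "0 < e" and fin: "(\<Sum>i. outer (A i)) < top"
  have less: "outer (A n) < outer (A n) + e * (1/2)^Suc n" for n
    using ennreal_suminf_lessD[OF fin, of n] e by (simp add: less_top)
  have "\<exists>U. open U \<and> A n \<subseteq> U \<and> inner_content U < outer (A n) + e * (1/2)^Suc n" for n
    using outer_approx[OF less[of n]] .
  then obtain U where U: "\<And>n. open (U n)" "\<And>n. A n \<subseteq> U n"
    "\<And>n. inner_content (U n) < outer (A n) + e * (1/2)^Suc n" by metis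
  have "outer (\<Union>i. A i) \<le> inner_content (\<Union>i. U i)" using U by (intro outer_le) auto
  also have "\<dots> \<le> (\<Sum>i. inner_content (U i))" using U by (intro inner_content_countable_Union) auto
  also have "\<dots> \<le> (\<Sum>n. outer (A n) + e * (1/2) ^ Suc n)"
    using U(3) by (intro suminf_le allI less_imp_le) auto
  also have "\<dots> = (\<Sum>n. outer (A n)) + (\<Sum>n. ennreal e * ennreal ((1/2) ^ Suc n))"
    using \<open>0 < e\<close> by (subst suminf_add[symmetric])
      (auto simp del: ennreal_suminf_cmult simp add: ennreal_mult[symmetric])
  also have "\<dots> = (\<Sum>n. outer (A n)) + e"
    unfolding ennreal_suminf_cmult
    by (subst suminf_ennreal_eq[OF zero_le_power power_half_series]) auto
  finally show "outer (\<Union>i. A i) \<le> (\<Sum>n. outer (A n)) + e" .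
qed

lemma outer_empty: "outer {} = 0"
  by (simp add: outer_open inner_content_disjoint)

lemma outer_measure_space_outer: "outer_measure_space (Pow UNIV) outer"
  by (auto simp: outer_measure_space_def positive_def outer_empty increasing_def outer_mono
      countably_subadditive_def outer_countably_subadditive)

lemma outer_Un: "outer (E \<union> F) \<le> outer E + outer F"
proof -
  have "outer (E \<union> F) = outer (\<Union>i::nat. binaryset E F i)" by (simp only: UN_binaryset_eq)
  also have "\<dots> \<le> (\<Sum>i. outer (binaryset E F i))" by (rule outer_countably_subadditive)
  also have "\<dots> = outer E + outer F" by (rule suminf_binaryset_eq[of outer, OF outer_empty])
  finally show ?thesis .
qed

text \<open>For open \<open>V\<close> containing \<open>E\<close>, the content of
  \<open>U \<inter> V\<close> is approached by values \<open>s a\<close>;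
  \<open>inner_content_split\<close> leaves the rest of \<open>V\<close> outside a closed subset of
  \<open>U\<close> to cover \<open>E - U\<close>.\<close>

lemma open_in_lambda_system:
  assumes "open U"
  shows "U \<in> lambda_system UNIV (Pow UNIV) outer"
proof -
  have "outer (U \<inter> E) + outer ((UNIV - U) \<inter> E) = outer E" for E
  proof (rule antisym)
    show "outer (U \<inter> E) + outer ((UNIV - U) \<inter> E) \<le> outer E"
    proof (rule outer_greatest)
      fix V assume V: "open V" "E \<subseteq> V"
      have "outer (U \<inter> E) + outer ((UNIV - U) \<inter> E) \<le> inner_content (U \<inter> V) + outer ((UNIV - U) \<inter> E)"
        using V assms by (intro add_right_mono outer_le) auto
      also have "\<dots> = (SUP a\<in>{a. supported a (U \<inter> V)}. ennreal (s a) + outer ((UNIV - U) \<inter> E))"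
        unfolding inner_content_def using supported_ex by (subst ennreal_SUP_add_left) auto
      also have "\<dots> \<le> inner_content V"
      proof (rule SUP_least, unfold mem_Collect_eq)
        fix a assume "supported a (U \<inter> V)"
        then obtain C where C: "closed C" "C \<subseteq> U \<inter> V" "ennreal (s a) + inner_content (V - C) \<le> inner_content V"
          using inner_content_split by blast
        have "outer ((UNIV - U) \<inter> E) \<le> inner_content (V - C)"
          using C V by (intro outer_le open_Diff) auto
        then show "ennreal (s a) + outer ((UNIV - U) \<inter> E) \<le> inner_content V"
          using C(3) add_left_mono order_trans by blast
      qed
      finally show "outer (U \<inter> E) + outer ((UNIV - U) \<inter> E) \<le> inner_content V" .
    qed
    have "E = (U \<inter> E) \<union> ((UNIV - U) \<inter> E)" by auto
    then show "outer E \<le> outer (U \<inter> E) + outer ((UNIV - U) \<inter> E)" by (metis outer_Un)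
  qed
  then show ?thesis unfolding lambda_system_def by simp
qed

lemma outer_measure_space: "measure_space UNIV (sets borel) outer"
proof -
  interpret P: sigma_algebra "UNIV :: 'b set" "Pow UNIV" by (rule sigma_algebra_Pow)
  have L: "measure_space UNIV (lambda_system UNIV (Pow UNIV) outer) outer"
    by (rule P.caratheodory_lemma[OF outer_measure_space_outer])
  then interpret L: sigma_algebra UNIV "lambda_system UNIV (Pow UNIV) outer"
    by (simp add: measure_space_def)
  have sub: "sets borel \<subseteq> lambda_system UNIV (Pow UNIV) outer"
    unfolding sets_borel by (rule L.sigma_sets_subset) (auto dest: open_in_lambda_system)
  show ?thesis
    using measure_down[OF L _ sub] sets.sigma_algebra_axioms[of "borel :: 'b measure"] by simp
qed

definition N :: "'b measure" where "N = measure_of UNIV (sets borel) outer"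

lemma sets_N [simp, measurable_cong]: "sets N = sets borel"
  unfolding N_def by (metis sets.sets_measure_of_eq space_borel)

lemma space_N [simp]: "space N = UNIV"
  unfolding N_def by (simp add: space_measure_of_conv)

lemma emeasure_N: "B \<in> sets borel \<Longrightarrow> emeasure N B = outer B"
  using outer_measure_space unfolding N_def measure_space_def
  by (intro emeasure_measure_of_sigma) auto

lemma N_UNIV: "emeasure N UNIV = 1"
  by (simp add: emeasure_N outer_open inner_content_UNIV)

sublocale N: prob_space N
  by standard (simp add: N_UNIV)

lemma N_outer:
  "B \<in> sets borel \<Longrightarrow> emeasure N B = (INF U\<in>{U. open U \<and> B \<subseteq> U}. emeasure N U)"
  unfolding emeasure_N by (subst outer_def) (simp add: emeasure_N outer_open cong: INF_cong_simp)

lemma N_off_S: "emeasure N (- S) = 0"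
  using closed_S by (simp add: emeasure_N outer_open open_Compl inner_content_disjoint)

text \<open>An open \<open>U\<close> barely larger than \<open>- B\<close> gives the compact set
  \<open>S \<inter> - U\<close> inside \<open>B\<close>; what it misses of \<open>B\<close> lies in
  \<open>- S\<close> or in the excess of \<open>U\<close>.\<close>

lemma N_inner:
  assumes B: "B \<in> sets borel"
  shows "emeasure N B = (SUP K\<in>{K. compact K \<and> closed K \<and> K \<subseteq> B}. emeasure N K)"
proof (rule antisym)
  show "(SUP K\<in>{K. compact K \<and> closed K \<and> K \<subseteq> B}. emeasure N K) \<le> emeasure N B"
    using B by (intro SUP_least emeasure_mono) auto
  show "emeasure N B \<le> (SUP K\<in>{K. compact K \<and> closed K \<and> K \<subseteq> B}. emeasure N K)"
  proof (rule ennreal_le_epsilon)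
    fix e :: real assume e: "0 < e"
    have "emeasure N (- B) < emeasure N (- B) + e"
      using e N.emeasure_finite by (simp add: less_top[symmetric])
    moreover have "- B \<in> sets borel" using B by auto
    ultimately have "outer (- B) < emeasure N (- B) + e" by (simp add: emeasure_N)
    then obtain U where U: "open U" "- B \<subseteq> U" "inner_content U < emeasure N (- B) + e"
      using outer_approx by blast
    define K where "K = S \<inter> - U"
    have K: "compact K" "closed K" "K \<subseteq> B"
      using U closed_S compact_S by (auto simp: K_def intro: compact_Int_closed)
    have "emeasure N B \<le> emeasure N (K \<union> - S \<union> (U - - B))"
      using K U B closed_S by (intro emeasure_mono) (auto simp: K_def)
    also have "\<dots> \<le> emeasure N (K \<union> - S) + emeasure N (U - - B)"
      using K U B closed_S by (intro emeasure_subadditive) auto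
    also have "\<dots> \<le> (emeasure N K + emeasure N (- S)) + emeasure N (U - - B)"
      using K U B closed_S by (intro add_right_mono emeasure_subadditive) auto
    also have "emeasure N (U - - B) = emeasure N U - emeasure N (- B)"
      using U B by (intro emeasure_Diff) (auto simp: N.emeasure_finite)
    also have "\<dots> \<le> e"
      using U by (simp add: emeasure_N outer_open ennreal_minus_le_iff N.emeasure_finite less_imp_le)
    finally have "emeasure N B \<le> emeasure N K + e" by (simp add: N_off_S)
    also have "emeasure N K \<le> (SUP K\<in>{K. compact K \<and> closed K \<and> K \<subseteq> B}. emeasure N K)"
      using K by (intro SUP_upper) simp
    finally show "emeasure N B \<le> (SUP K\<in>{K. compact K \<and> closed K \<and> K \<subseteq> B}. emeasure N K) + e"
      by simp
  qed
qed

end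

section \<open>The integral representation\<close>

lemma sum_threshold_le:
  fixes v :: real
  assumes "0 \<le> v"
  shows "(\<Sum>i<n. of_bool (real i \<le> v)) \<le> v + 1"
proof -
  have "(\<Sum>i<n. of_bool (real i \<le> v) :: real) = real (card {i \<in> {..<n}. real i \<le> v})"
    by (simp add: of_bool_def flip: sum.inter_filter)
  also have "card {i \<in> {..<n}. real i \<le> v} \<le> card {..nat \<lfloor>v\<rfloor>}"
    by (intro card_mono) (auto simp: le_nat_floor)
  also have "real (card {..nat \<lfloor>v\<rfloor>}) \<le> v + 1" using assms by simp
  finally show ?thesis by simp
qed

context mv_state
begin

lemma S_sets: "S \<in> sets borel"
  using closed_S by simp

lemma set_integrable_\<phi>:
  assumes "finite_measure M" and M: "sets M = sets (restrict_space borel X)" and "S \<subseteq> X"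
  shows "set_integrable M S (\<phi> a)"
proof -
  interpret finite_measure M by fact
  have "\<phi> a \<in> borel_measurable borel" using cont by (rule borel_measurable_continuous_onI)
  then have [measurable]: "\<phi> a \<in> borel_measurable M"
    using measurable_restrict_space1 by (subst measurable_cong_sets[OF M refl]) blast
  have [measurable]: "S \<in> sets M"
    using S_sets assms(3) unfolding M sets_restrict_space by (intro image_eqI[of _ _ S]) auto
  show ?thesis unfolding set_integrable_def
    by (rule integrable_const_bound[where B = 1])
      (use range01 in \<open>auto simp: indicator_def intro!: AE_I2\<close>)
qed

text \<open>Every open set containing \<open>E\<close> supports \<open>b\<close>, with
  \<open>- E\<close> as the open set of zeros.\<close>

lemma s_le_measure:
  assumes "closed E" and off: "\<And>x. x \<in> S \<Longrightarrow> x \<notin> E \<Longrightarrow> \<phi> b x = 0"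
  shows "s b \<le> measure N E"
proof -
  have "ennreal (s b) \<le> outer E"
  proof (rule outer_greatest)
    fix U assume "open U" "E \<subseteq> U"
    then have "supported b U"
      by (intro supportedI[of "- E"]) (use assms in auto)
    then show "ennreal (s b) \<le> inner_content U" by (rule inner_content_upper)
  qed
  also have "\<dots> = emeasure N E" using assms(1) by (simp add: emeasure_N)
  finally show ?thesis by (simp add: N.emeasure_eq_measure)
qed

text \<open>A layer-cake estimate: the slices of the \<open>n\<close>-fold multiple bound
  \<open>n * s a\<close> by a sum of measures of level sets, which is at most \<open>n\<close> times
  the integral plus 1. The error 1 is negligible for large \<open>n\<close>.\<close>

lemma s_le_integral: "s a \<le> (LINT x:S|N. \<phi> a x)"
proof (rule ccontr)
  define I where "I = (LINT x:S|N. \<phi> a x)"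
  assume "\<not> s a \<le> (LINT x:S|N. \<phi> a x)"
  then have "0 < s a - I" by (simp add: I_def)
  then obtain n :: nat where n: "1 < real n * (s a - I)"
    using reals_Archimedean3 by blast
  obtain g where g: "\<And>k x. x \<in> S \<Longrightarrow> \<phi> (g k) x = max 0 (min 1 (real n * \<phi> a x - real k))"
    and gs: "real n * s a = (\<Sum>k<n. s (g k))" using multiple_slices by blast
  define E where "E = (\<lambda>i::nat. S \<inter> {x. real i \<le> real n * \<phi> a x})"
  have E: "closed (E i)" for i
    unfolding E_def by (intro closed_Int closed_S closed_Collect_le continuous_intros cont)
  have int: "integrable N (\<lambda>x. indicator S x *\<^sub>R \<phi> a x)"
    using set_integrable_\<phi>[of N UNIV a] N.finite_measure_axioms
    by (simp add: set_integrable_def sets_restrict_UNIV)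
  have lin: "(\<integral>x. real n * f x + 1 \<partial>N) = real n * (\<integral>x. f x \<partial>N) + 1"
    if "integrable N f" for f :: "'b \<Rightarrow> real"
    using that N.prob_space by simp
  have "real n * s a \<le> (\<Sum>i<n. measure N (E i))"
    unfolding gs by (intro sum_mono s_le_measure E) (auto simp: g E_def)
  also have "\<dots> = (\<integral>x. (\<Sum>i<n. indicator (E i) x) \<partial>N)"
    using E by (subst Bochner_Integration.integral_sum) (auto simp: N.emeasure_eq_measure)
  also have "\<dots> \<le> (\<integral>x. real n * (indicator S x *\<^sub>R \<phi> a x) + 1 \<partial>N)"
  proof (rule integral_mono)
    show "integrable N (\<lambda>x. \<Sum>i<n. indicator (E i) x :: real)"
      using E by (intro Bochner_Integration.integrable_sum) (auto simp: N.emeasure_eq_measure)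
    show "integrable N (\<lambda>x. real n * (indicator S x *\<^sub>R \<phi> a x) + 1)"
      using int by simp
    fix x
    show "(\<Sum>i<n. indicator (E i) x) \<le> real n * (indicator S x *\<^sub>R \<phi> a x) + 1"
    proof (cases "x \<in> S")
      case True
      then have "0 \<le> real n * \<phi> a x" using range01[of x a] by simp
      from sum_threshold_le[OF this, of n] True show ?thesis
        by (simp add: E_def indicator_def of_bool_def)
    qed (simp add: E_def indicator_def)
  qed
  also have "\<dots> = real n * I + 1"
    by (simp only: I_def set_lebesgue_integral_def lin[OF int])
  finally show False using n by (simp add: algebra_simps)
qed

lemma N_S: "measure N S = 1"
proof -
  have "measure N (- S) = 0" using N_off_S by (simp add: measure_def)
  then show ?thesis using N.prob_compl[of S] S_sets by (simp add: Compl_eq_Diff_UNIV)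
qed

text \<open>The reverse inequality is \<open>s_le_integral\<close> applied to the negation of
  \<open>a\<close>, using that \<open>N\<close> gives \<open>S\<close> full mass.\<close>

lemma s_eq_integral: "s a = (LINT x:S|N. \<phi> a x)"
proof (rule antisym[OF s_le_integral])
  obtain b where b: "\<forall>x\<in>S. \<phi> b x = 1 - \<phi> a x" using neg_ex by blast
  have int: "set_integrable N S (\<phi> a)"
    using set_integrable_\<phi>[of N UNIV a] N.finite_measure_axioms by (simp add: sets_restrict_UNIV)
  have one: "set_integrable N S (\<lambda>_. 1 :: real)"
    using S_sets by (simp add: set_integrable_def N.emeasure_eq_measure)
  have "1 - s a = s b" using s_neg[of b a] b by simp
  also have "\<dots> \<le> (LINT x:S|N. \<phi> b x)" by (rule s_le_integral)
  also have "\<dots> = (LINT x:S|N. 1 - \<phi> a x)"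
    using b S_sets by (intro set_lebesgue_integral_cong) auto
  also have "\<dots> = (LINT x:S|N. 1) - (LINT x:S|N. \<phi> a x)"
    using one int by (rule set_integral_diff)
  also have "(LINT x:S|N. 1 :: real) = 1"
    using S_sets N_S by (simp add: set_lebesgue_integral_def)
  finally show "(LINT x:S|N. \<phi> a x) \<le> s a" by simp
qed

text \<open>\<open>N\<close> is concentrated on \<open>S \<subseteq> X\<close>, so restricting to
  \<open>X\<close> loses neither mass nor integrals; outer regularity passes to the relatively open
  sets \<open>X \<inter> W\<close>.\<close>

lemma restrict_N_represents:
  assumes X: "closed X" "S \<subseteq> X"
  shows "regular_borel_prob_on X (restrict_space N X)"
    and "s a = (LINT x:S|restrict_space N X. \<phi> a x)"
proof -
  have Xs: "X \<in> sets borel" using X by simp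
  have em: "emeasure (restrict_space N X) B = emeasure N B" if "B \<subseteq> X" for B
    using that Xs by (intro emeasure_restrict_space) auto
  have sets: "sets (restrict_space N X) = sets (restrict_space borel X)"
    by (rule sets_restrict_space_cong) simp
  have "emeasure N S \<le> emeasure N X" using X Xs by (intro emeasure_mono) auto
  then have "emeasure N X = 1"
    using N_S N.prob_le_1[of X] by (simp add: N.emeasure_eq_measure)
  then have prob: "prob_space (restrict_space N X)"
    by (intro prob_spaceI) (simp add: space_restrict_space em)
  show "regular_borel_prob_on X (restrict_space N X)"
    unfolding regular_borel_prob_on_def
  proof (intro conjI ballI sets prob)
    fix B assume B: "B \<in> sets (restrict_space N X)"
    then have BX: "B \<subseteq> X" "B \<in> sets borel"
      using Xs by (auto simp: sets sets_restrict_space)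
    show "emeasure (restrict_space N X) B = (SUP K\<in>{K. compact K \<and> K \<subseteq> B}. emeasure (restrict_space N X) K)"
    proof (rule antisym)
      show "(SUP K\<in>{K. compact K \<and> K \<subseteq> B}. emeasure (restrict_space N X) K) \<le> emeasure (restrict_space N X) B"
        using B by (intro SUP_least emeasure_mono) auto
      show "emeasure (restrict_space N X) B \<le> (SUP K\<in>{K. compact K \<and> K \<subseteq> B}. emeasure (restrict_space N X) K)"
        unfolding em[OF BX(1)] N_inner[OF BX(2)]
      proof (rule SUP_mono)
        fix K assume "K \<in> {K. compact K \<and> closed K \<and> K \<subseteq> B}"
        then show "\<exists>L\<in>{K. compact K \<and> K \<subseteq> B}. emeasure N K \<le> emeasure (restrict_space N X) L"
          using BX em[of K] by (intro bexI[of _ K]) auto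
      qed
    qed
    show "emeasure (restrict_space N X) B =
      (INF U\<in>{U. openin (top_of_set X) U \<and> B \<subseteq> U}. emeasure (restrict_space N X) U)"
    proof (rule antisym)
      show "emeasure (restrict_space N X) B \<le>
        (INF U\<in>{U. openin (top_of_set X) U \<and> B \<subseteq> U}. emeasure (restrict_space N X) U)"
      proof (intro INF_greatest emeasure_mono)
        fix U assume "U \<in> {U. openin (top_of_set X) U \<and> B \<subseteq> U}"
        then show "B \<subseteq> U" "U \<in> sets (restrict_space N X)"
          by (auto simp: sets sets_restrict_space openin_open)
      qed
      show "(INF U\<in>{U. openin (top_of_set X) U \<and> B \<subseteq> U}. emeasure (restrict_space N X) U) \<le>
        emeasure (restrict_space N X) B"
        unfolding em[OF BX(1)] N_outer[OF BX(2)]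
      proof (rule INF_mono)
        fix W assume W: "W \<in> {U. open U \<and> B \<subseteq> U}"
        then have "emeasure N (X \<inter> W) \<le> emeasure N W" by (intro emeasure_mono) auto
        then show "\<exists>U\<in>{U. openin (top_of_set X) U \<and> B \<subseteq> U}.
            emeasure (restrict_space N X) U \<le> emeasure N W"
          using W BX em[of "X \<inter> W"] by (intro bexI[of _ "X \<inter> W"]) (auto simp: openin_open)
      qed
    qed
  qed
  have "(LINT x:S|restrict_space N X. \<phi> a x) = (LINT x|N. indicator X x *\<^sub>R (indicator S x *\<^sub>R \<phi> a x))"
    unfolding set_lebesgue_integral_def using Xs by (intro integral_restrict_space) simp
  also have "\<dots> = (LINT x:S|N. \<phi> a x)"
    unfolding set_lebesgue_integral_def
    by (intro Bochner_Integration.integral_cong refl) (use X in \<open>auto simp: indicator_def\<close>)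
  finally show "s a = (LINT x:S|restrict_space N X. \<phi> a x)" by (simp add: s_eq_integral)
qed

section \<open>Uniqueness of the representing measure\<close>

text \<open>A Urysohn element \<open>b\<close>, equal to 1 on \<open>S \<inter> K\<close> and 0 on
  \<open>S - U\<close>, has the same integral \<open>s b\<close> for both measures, and this
  integral lies between the two sides.\<close>

lemma represents_compact_le_open:
  assumes \<mu>: "regular_borel_prob_on X \<mu>" "\<And>a. s a = (LINT x:S|\<mu>. \<phi> a x)"
    and \<nu>: "regular_borel_prob_on X \<nu>" "\<And>a. s a = (LINT x:S|\<nu>. \<phi> a x)"
    and SX: "S \<subseteq> X" and K: "compact K" "closed K" "K \<subseteq> X"
    and U: "openin (top_of_set X) U" "K \<subseteq> U"
  shows "emeasure \<mu> K \<le> emeasure \<nu> U"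
proof -
  have sets: "sets \<mu> = sets (restrict_space borel X)" "sets \<nu> = sets (restrict_space borel X)"
    using \<mu> \<nu> by (simp_all add: regular_borel_prob_on_def)
  interpret \<mu>: prob_space \<mu> using \<mu> by (simp add: regular_borel_prob_on_def)
  interpret \<nu>: prob_space \<nu> using \<nu> by (simp add: regular_borel_prob_on_def)
  have in_sets: "X \<inter> B \<in> sets \<mu>" "X \<inter> B \<in> sets \<nu>" if "B \<in> sets borel" for B
    using that by (auto simp: sets sets_restrict_space)
  have S: "S \<in> sets \<mu>" using in_sets[OF S_sets] SX by (simp add: Int_absorb1)
  have Ks: "K \<in> sets \<mu>" using in_sets[of K] K by (simp add: Int_absorb1)
  obtain W where W: "open W" "U = X \<inter> W" using U(1) by (auto simp: openin_open)
  have Us: "U \<in> sets \<nu>" using in_sets[of W] W by simp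
  have "separated (S \<inter> K) (S \<inter> - W)"
    by (rule separated_disjoint_compacts)
      (use K U W in \<open>auto intro!: compact_Int_closed compact_S\<close>)
  then obtain b P Q where b: "S \<inter> K \<subseteq> P" "S \<inter> - W \<subseteq> Q"
    "\<And>x. x \<in> S \<Longrightarrow> x \<in> P \<Longrightarrow> \<phi> b x = 1" "\<And>x. x \<in> S \<Longrightarrow> x \<in> Q \<Longrightarrow> \<phi> b x = 0"
    by (rule separatedE) (rule that)
  \<comment> \<open>Representing the constant 1 forces \<open>\<mu>\<close>, a measure on all of
    \<open>X\<close>, to be concentrated on \<open>S\<close>.\<close>
  obtain c where c: "\<forall>x\<in>S. \<phi> c x = 1" using one_ex by blast
  have "1 = (LINT x:S|\<mu>. \<phi> c x)" using unit[of c] c \<mu>(2)[of c] by simp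
  also have "\<dots> = (LINT x:S|\<mu>. 1)"
    using c S by (intro set_lebesgue_integral_cong) auto
  finally have "measure \<mu> S = 1" using S by (simp add: set_lebesgue_integral_def)
  then have "AE x in \<mu>. x \<in> S" using \<mu>.prob_eq_1[OF S] by simp
  then have "measure \<mu> K = measure \<mu> (S \<inter> K)"
    using Ks S by (intro \<mu>.finite_measure_eq_AE) auto
  also have "\<dots> = (\<integral>x. indicator (S \<inter> K) x \<partial>\<mu>)" using Ks S by simp
  also have "\<dots> \<le> (LINT x:S|\<mu>. \<phi> b x)"
    unfolding set_lebesgue_integral_def
  proof (rule integral_mono)
    show "integrable \<mu> (indicator (S \<inter> K) :: _ \<Rightarrow> real)"
      using Ks S by (simp add: \<mu>.emeasure_eq_measure)
    show "integrable \<mu> (\<lambda>x. indicator S x *\<^sub>R \<phi> b x)"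
      using set_integrable_\<phi>[OF \<mu>.finite_measure_axioms sets(1) SX] by (simp add: set_integrable_def)
    show "indicator (S \<inter> K) x \<le> indicator S x *\<^sub>R \<phi> b x" for x
      using b(1,3) range01[of x b] by (auto simp: indicator_def)
  qed
  also have "\<dots> = (LINT x:S|\<nu>. \<phi> b x)" using \<mu>(2)[of b] \<nu>(2)[of b] by simp
  also have "\<dots> \<le> (\<integral>x. indicator U x \<partial>\<nu>)"
    unfolding set_lebesgue_integral_def
  proof (rule integral_mono)
    show "integrable \<nu> (indicator U :: _ \<Rightarrow> real)"
      using Us by (simp add: \<nu>.emeasure_eq_measure)
    show "integrable \<nu> (\<lambda>x. indicator S x *\<^sub>R \<phi> b x)"
      using set_integrable_\<phi>[OF \<nu>.finite_measure_axioms sets(2) SX] by (simp add: set_integrable_def)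
    show "indicator S x *\<^sub>R \<phi> b x \<le> indicator U x" for x
      using b(2,4) range01[of x b] SX W(2) by (auto simp: indicator_def)
  qed
  also have "\<dots> = measure \<nu> U" using Us by simp
  finally show ?thesis by (simp add: \<mu>.emeasure_eq_measure \<nu>.emeasure_eq_measure)
qed

text \<open>Outer regularity sharpens the comparison with open sets to compact sets, symmetry gives
  equality there, and inner regularity extends it to all Borel sets. Closedness of compact sets
  makes them Borel.\<close>

lemma representing_measure_unique:
  assumes \<mu>: "regular_borel_prob_on X \<mu>" "\<And>a. s a = (LINT x:S|\<mu>. \<phi> a x)"
    and \<nu>: "regular_borel_prob_on X \<nu>" "\<And>a. s a = (LINT x:S|\<nu>. \<phi> a x)"
    and SX: "S \<subseteq> X" and closed: "\<And>K :: 'b set. compact K \<Longrightarrow> closed K"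
  shows "\<mu> = \<nu>"
proof (rule measure_eqI)
  have sets: "sets \<mu> = sets (restrict_space borel X)" "sets \<nu> = sets (restrict_space borel X)"
    using \<mu> \<nu> by (simp_all add: regular_borel_prob_on_def)
  show "sets \<mu> = sets \<nu>" by (simp add: sets)
  have le: "emeasure \<mu> K \<le> emeasure \<nu> K"
    if "regular_borel_prob_on X \<mu>" "\<And>a. s a = (LINT x:S|\<mu>. \<phi> a x)"
      "regular_borel_prob_on X \<nu>" "\<And>a. s a = (LINT x:S|\<nu>. \<phi> a x)"
      "compact K" "K \<subseteq> X" for \<mu> \<nu> :: "'b measure" and K
  proof -
    have "K \<in> sets \<nu>"
      using that(3,6) closed[OF that(5)]
      by (auto simp: regular_borel_prob_on_def sets_restrict_space intro!: image_eqI[of _ _ K])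
    then have "emeasure \<nu> K = (INF U\<in>{U. openin (top_of_set X) U \<and> K \<subseteq> U}. emeasure \<nu> U)"
      using that(3) unfolding regular_borel_prob_on_def by blast
    then show ?thesis
      using represents_compact_le_open[OF that(1-4) SX that(5) closed[OF that(5)] that(6)]
      by (auto intro: INF_greatest)
  qed
  fix B assume B: "B \<in> sets \<mu>"
  then have "B \<subseteq> X" by (auto simp: sets sets_restrict_space)
  have "emeasure \<mu> K = emeasure \<nu> K" if "compact K" "K \<subseteq> B" for K
    using le[OF \<mu> \<nu>] le[OF \<nu> \<mu>] that \<open>B \<subseteq> X\<close> by (intro antisym) auto
  then have "(SUP K\<in>{K. compact K \<and> K \<subseteq> B}. emeasure \<mu> K) = (SUP K\<in>{K. compact K \<and> K \<subseteq> B}. emeasure \<nu> K)"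
    by (intro SUP_cong) auto
  then show "emeasure \<mu> B = emeasure \<nu> B"
    using \<mu>(1) \<nu>(1) B unfolding regular_borel_prob_on_def by (metis (no_types, lifting))
qed

end

subsection \<open>The representation theorem\<close>

theorem theorem6p4:
  fixes le :: "'a \<Rightarrow> 'a \<Rightarrow> bool"
    and arr sqg :: "'a \<Rightarrow> 'a \<Rightarrow> 'a"
    and one zero :: 'a
    and s :: "'a \<Rightarrow> real"
  assumes "bounded_pseudo_bck le arr sqg one zero"
    and "s \<in> bosbach_states arr sqg one zero"
  shows "\<exists>!\<mu> :: ('a \<Rightarrow> real) measure.
    regular_borel_prob_on (bosbach_states arr sqg one zero) \<mu> \<and>
    (\<forall>a. s a = (LINT t:state_morphisms arr sqg zero|\<mu>. t a))"
proof -
  interpret bosbach_state le arr sqg one zero s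
    using assms by (simp add: bosbach_state_def bosbach_state_axioms_def)
  have mor: "m zero = 0" "m (arr x y) = min (1 - m x + m y) 1" "0 \<le> m x \<and> m x \<le> 1"
    if "m \<in> state_morphisms arr sqg zero" for m x y
    using that by (auto simp: state_morphisms_def)
  \<comment> \<open>Elements of the algebra index their evaluation maps on the
    state-morphisms.\<close>
  interpret mv_state "state_morphisms arr sqg zero" "\<lambda>a m. m a" s
  proof
    show "compact (state_morphisms arr sqg zero)" by (rule compact_state_morphisms)
    then show "closed (state_morphisms arr sqg zero)" by (rule compact_imp_closed_fun)
    show "\<exists>b. \<forall>m\<in>state_morphisms arr sqg zero. m b = 1 - m a" for a
      by (intro exI[of _ "arr a zero"]) (simp add: mor)
    show "\<exists>c. \<forall>m\<in>state_morphisms arr sqg zero. m c = min (m a + m b) 1" for a b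
      \<comment> \<open>The MV sum, with \<open>arr a zero\<close> as the negation of
        \<open>a\<close>.\<close>
      by (intro exI[of _ "arr (arr a zero) b"]) (simp add: mor)
    show "s a = 1" if "\<And>m. m \<in> state_morphisms arr sqg zero \<Longrightarrow> m a = 1" for a
    proof -
      have "s one \<le> s a" by (rule state_mono_of_morphisms) (simp add: that state_morphism_one)
      then show ?thesis using t_one t_le[of a] by simp
    qed
    show "continuous_on UNIV (\<lambda>m :: 'a \<Rightarrow> real. m a)" for a by (rule continuous_on_apply)
    show "\<exists>a. m a \<noteq> m' a" if "m \<noteq> m'" for m m' :: "'a \<Rightarrow> real" using that by auto
    show "0 \<le> m a \<and> m a \<le> 1" if "m \<in> state_morphisms arr sqg zero" for m a
      using that by (rule mor)
  qed (fact state_mono_of_morphisms state_additive_of_morphisms)+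
  let ?X = "bosbach_states arr sqg one zero"
  have "closed ?X" by (rule compact_imp_closed_fun[OF compact_bosbach_states])
  note N = restrict_N_represents[OF this state_morphisms_subset]
  show ?thesis
  proof (rule ex1I[of _ "restrict_space N ?X"])
    show "regular_borel_prob_on ?X (restrict_space N ?X) \<and>
        (\<forall>a. s a = (LINT t:state_morphisms arr sqg zero|restrict_space N ?X. t a))"
      using N by simp
    fix \<mu>
    assume "regular_borel_prob_on ?X \<mu> \<and> (\<forall>a. s a = (LINT t:state_morphisms arr sqg zero|\<mu>. t a))"
    then have \<mu>: "regular_borel_prob_on ?X \<mu>" "\<And>a. s a = (LINT t:state_morphisms arr sqg zero|\<mu>. t a)"
      by simp_all
    show "\<mu> = restrict_space N ?X"
      by (rule representing_measure_unique[OF \<mu> N state_morphisms_subset compact_imp_closed_fun])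
  qed
qed

end
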